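(* Let $H$ be a finitely generated subgroup of a free group $F$ of finite rank $r>1$, and let $g\in F$, $g\ne e$, be such that $H\cap\langle g\rangle$ is trivial. Let $\mathcal{C}$ be the core of the Cayley graph $\mathcal{G}(F/H)$. Then for any $\varepsilon\in(0,\mathrm{def}(\mathcal{C}))$ there exist a natural number $n=n(g,H)$ and a subgroup $H_1$ of infinite index in $F$ containing $g^n$ such that $H_1=H*\langle g^n\rangle$ and $\mathrm{def}(\mathcal{C})-\mathrm{def}(\mathcal{C}_1)\le\varepsilon$, where $\mathcal{C}_1$ is the core of the Cayley graph $\mathcal{G}(F/H_1)$.
   Context: Fix a free basis $\{a_1,\ldots,a_r\}$ of $F$ and put $A=\{a_1^{\pm1},\ldots,a_r^{\pm1}\}$. For a subgroup $H\le F$, the Cayley graph $\mathcal{G}(F/H)$ of the right action of $F$ on the set $F/H$ of right cosets has vertex set $F/H$, distinguished vertex $o=H$, and for every vertex $s$ and every $a\in A$ exactly one directed edge with source $s$, target $sa$ and label $a$; the edge from $sa$ to $s$ labelled $a^{-1}$ is its inverse. A path is reduced if it contains no subpath $ee^{-1}$. The core $\mathcal{C}$ of $\mathcal{G}(F/H)$ is the minimal subgraph containing $o$ and all reduced loops originating (and ending) in $o$ (together with each edge it contains its inverse). For a vertex $v$ of $\mathcal{C}$ let $d_{\mathcal{C}}(v)$ be the number of edges of $\mathcal{C}$ with source $v$, let $\mathrm{def}_{\mathcal{C}}(v)=2r-d_{\mathcal{C}}(v)$, and let $|v|$ be the distance from $o$ to $v$. The deficit of the core is $\mathrm{def}(\mathcal{C})=\sum_{v\in\mathcal{C}}\mathrm{def}_{\mathcal{C}}(v)(2r-1)^{-|v|}$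 (a convergent sum, at most $2r$). $H*\langle g^n\rangle$ denotes the internal free product: $H_1$ is generated by $H$ and $g^n$ and is their free product. *)

theory Defs
  imports
    "HOL-Analysis.Infinite_Sum"
    "HOL-Algebra.Generated_Groups"
    "Graph_Theory.Graph_Theory"
begin

section \<open>Free bases and internal free products\<close>

definition group_prod :: "('a, 'b) monoid_scheme \<Rightarrow> 'a list \<Rightarrow> 'a" where
  "group_prod G xs = foldr (\<otimes>\<^bsub>G\<^esub>) xs \<one>\<^bsub>G\<^esub>"

text \<open>The pair \<open>(x, True)\<close> stands for the letter \<open>x\<close>, the pair \<open>(x, False)\<close> for \<open>x\<inverse>\<close>.\<close>

definition letter_val :: "('a, 'b) monoid_scheme \<Rightarrow> 'a \<times> bool \<Rightarrow> 'a" where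
  "letter_val G l = (if snd l then fst l else inv\<^bsub>G\<^esub> (fst l))"

definition reduced_words :: "'a set \<Rightarrow> ('a \<times> bool) list set" where
  "reduced_words X =
     {w. fst ` set w \<subseteq> X \<and> successively (\<lambda>l m. \<not> (fst l = fst m \<and> snd l \<noteq> snd m)) w}"

definition free_basis :: "('a, 'b) monoid_scheme \<Rightarrow> 'a set \<Rightarrow> bool" where
  "free_basis G X \<longleftrightarrow>
     X \<subseteq> carrier G \<and> generate G X = carrier G \<and>
     inj_on (\<lambda>w. group_prod G (map (letter_val G) w)) (reduced_words X)"

definition finitely_generated_subgroup :: "'a set \<Rightarrow> ('a, 'b) monoid_scheme \<Rightarrow> bool" where
  "finitely_generated_subgroup H G \<longleftrightarrow>
     (\<exists>S. finite S \<and> S \<subseteq> carrier G \<and> H = generate G S)"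

text \<open>Normal forms of the free product of \<open>H\<close> and \<open>K\<close>: words of non-trivial elements taken
  alternately from the two factors, where the tag records the factor
  (\<open>True\<close> for \<open>H\<close>, \<open>False\<close> for \<open>K\<close>).\<close>

definition alternating_words ::
    "('a, 'b) monoid_scheme \<Rightarrow> 'a set \<Rightarrow> 'a set \<Rightarrow> (bool \<times> 'a) list set" where
  "alternating_words G H K =
     {w. (\<forall>(t, x) \<in> set w. x \<in> (if t then H else K) \<and> x \<noteq> \<one>\<^bsub>G\<^esub>) \<and>
         successively (\<lambda>l m. fst l \<noteq> fst m) w}"

definition internal_free_product ::
    "('a, 'b) monoid_scheme \<Rightarrow> 'a set \<Rightarrow> 'a set \<Rightarrow> 'a set \<Rightarrow> bool" where
  "internal_free_product G H K L \<longleftrightarrow>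
     subgroup H G \<and> subgroup K G \<and> L = generate G (H \<union> K) \<and>
     inj_on (\<lambda>w. group_prod G (map snd w)) (alternating_words G H K)"


section \<open>Cayley graphs of coset actions\<close>

definition sym_letters :: "('a, 'b) monoid_scheme \<Rightarrow> 'a set \<Rightarrow> 'a set" where
  "sym_letters G X = X \<union> (\<lambda>x. inv\<^bsub>G\<^esub> x) ` X"

text \<open>The arc \<open>(s, a)\<close> has source \<open>s\<close>, target \<open>s #> a\<close> and label \<open>a\<close>. The distinguished
  vertex is the coset \<open>H\<close> itself.\<close>

definition cayley_graph ::
    "('a, 'b) monoid_scheme \<Rightarrow> 'a set \<Rightarrow> 'a set \<Rightarrow> ('a set, 'a set \<times> 'a) pre_digraph" where
  "cayley_graph G X H =
     \<lparr> verts = rcosets\<^bsub>G\<^esub> H, arcs = (rcosets\<^bsub>G\<^esub> H) \<times> sym_letters G X,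
       tail = fst, head = (\<lambda>(s, a). s #>\<^bsub>G\<^esub> a) \<rparr>"

definition inverse_arc :: "('a, 'b) monoid_scheme \<Rightarrow> 'a set \<times> 'a \<Rightarrow> 'a set \<times> 'a" where
  "inverse_arc G e = (fst e #>\<^bsub>G\<^esub> snd e, inv\<^bsub>G\<^esub> (snd e))"

definition reduced_path :: "('a, 'b) monoid_scheme \<Rightarrow> ('a set \<times> 'a) list \<Rightarrow> bool" where
  "reduced_path G p \<longleftrightarrow> successively (\<lambda>e f. f \<noteq> inverse_arc G e) p"

definition reduced_loops ::
    "('a, 'b) monoid_scheme \<Rightarrow> 'a set \<Rightarrow> 'a set \<Rightarrow> ('a set \<times> 'a) list set" where
  "reduced_loops G X H =
     {p. pre_digraph.awalk (cayley_graph G X H) H p H \<and> reduced_path G p}"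

definition contains_reduced_loops ::
    "('a, 'b) monoid_scheme \<Rightarrow> 'a set \<Rightarrow> 'a set \<Rightarrow> ('a set, 'a set \<times> 'a) pre_digraph \<Rightarrow> bool" where
  "contains_reduced_loops G X H C \<longleftrightarrow>
     subgraph C (cayley_graph G X H) \<and> inverse_arc G ` arcs C \<subseteq> arcs C \<and>
     H \<in> verts C \<and> (\<forall>p \<in> reduced_loops G X H. set p \<subseteq> arcs C)"

text \<open>The smallest subgraph satisfying \<^const>\<open>contains_reduced_loops\<close>; see
  \<open>core_least\<close> below.\<close>

definition core ::
    "('a, 'b) monoid_scheme \<Rightarrow> 'a set \<Rightarrow> 'a set \<Rightarrow> ('a set, 'a set \<times> 'a) pre_digraph" where
  "core G X H =
     \<lparr> verts = \<Inter> (verts ` Collect (contains_reduced_loops G X H)),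
       arcs = \<Inter> (arcs ` Collect (contains_reduced_loops G X H)),
       tail = tail (cayley_graph G X H), head = head (cayley_graph G X H) \<rparr>"

lemma (in group) wf_cayley_graph:
  assumes "X \<subseteq> carrier G" "subgroup H G"
  shows "wf_digraph (cayley_graph G X H)"
proof
  have X: "sym_letters G X \<subseteq> carrier G"
    using assms(1) by (auto simp: sym_letters_def)
  have H: "H \<subseteq> carrier G"
    using assms(2) by (rule subgroup.subset)
  fix e assume "e \<in> arcs (cayley_graph G X H)"
  then obtain s a where e: "e = (s, a)" "s \<in> rcosets H" "a \<in> carrier G"
    using X by (auto simp: cayley_graph_def)
  then obtain y where "y \<in> carrier G" "s = H #> y"
    by (auto simp: RCOSETS_def)
  then have "s #> a = H #> (y \<otimes> a)" "y \<otimes> a \<in> carrier G"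
    using H e by (auto simp: coset_mult_assoc)
  then show "head (cayley_graph G X H) e \<in> verts (cayley_graph G X H)"
    using e by (auto simp: cayley_graph_def RCOSETS_def)
  show "tail (cayley_graph G X H) e \<in> verts (cayley_graph G X H)"
    using e by (auto simp: cayley_graph_def)
qed

lemma (in group) contains_reduced_loops_cayley_graph:
  assumes "X \<subseteq> carrier G" "subgroup H G"
  shows "contains_reduced_loops G X H (cayley_graph G X H)"
proof -
  have wf: "wf_digraph (cayley_graph G X H)"
    using assms by (rule wf_cayley_graph)
  have inv: "inv a \<in> sym_letters G X" if "a \<in> sym_letters G X" for a
    using that assms(1) by (auto simp: sym_letters_def)
  have "H #> \<one> = H"
    using subgroup.subset[OF assms(2)] by (rule coset_mult_one)
  then have "H \<in> verts (cayley_graph G X H)"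
    by (auto simp: cayley_graph_def RCOSETS_def)
  moreover have "inverse_arc G e \<in> arcs (cayley_graph G X H)"
    if "e \<in> arcs (cayley_graph G X H)" for e
    using wf_digraph.head_in_verts[OF wf that] that inv
    by (auto simp: cayley_graph_def inverse_arc_def)
  ultimately show ?thesis
    using wf
    by (auto simp: contains_reduced_loops_def reduced_loops_def pre_digraph.awalk_def
        subgraph_def compatible_def)
qed

lemma (in group) core_least:
  assumes "X \<subseteq> carrier G" "subgroup H G"
  shows "contains_reduced_loops G X H (core G X H)"
    and "contains_reduced_loops G X H C \<Longrightarrow> subgraph (core G X H) C"
proof -
  have top: "contains_reduced_loops G X H (cayley_graph G X H)"
    using assms by (rule contains_reduced_loops_cayley_graph)
  have ends: "tail (cayley_graph G X H) e \<in> verts D \<and> head (cayley_graph G X H) e \<in> verts D"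
    if "contains_reduced_loops G X H D" "e \<in> arcs D" for D e
    using that unfolding contains_reduced_loops_def subgraph_def compatible_def
    by (metis wf_digraph.wellformed)
  have wf: "wf_digraph (core G X H)"
    by unfold_locales (use ends in \<open>auto simp: core_def\<close>)
  have arcsI: "e \<in> arcs (core G X H)"
    if "\<And>D. contains_reduced_loops G X H D \<Longrightarrow> e \<in> arcs D" for e
    using that by (auto simp: core_def)
  have arcsD: "e \<in> arcs D" if "e \<in> arcs (core G X H)" "contains_reduced_loops G X H D" for e D
    using that by (auto simp: core_def)
  have "subgraph (core G X H) (cayley_graph G X H)"
    using top wf
    by (auto simp: core_def contains_reduced_loops_def subgraph_def compatible_def)
  moreover have "inverse_arc G e \<in> arcs (core G X H)" if "e \<in> arcs (core G X H)" for e
  proof (rule arcsI)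
    fix D assume D: "contains_reduced_loops G X H D"
    then have "inverse_arc G ` arcs D \<subseteq> arcs D"
      by (simp add: contains_reduced_loops_def)
    with arcsD[OF that D] show "inverse_arc G e \<in> arcs D" by blast
  qed
  moreover have "H \<in> verts (core G X H)"
    by (auto simp: core_def contains_reduced_loops_def)
  moreover have "e \<in> arcs (core G X H)" if "p \<in> reduced_loops G X H" "e \<in> set p" for p e
  proof (rule arcsI)
    fix D assume "contains_reduced_loops G X H D"
    then have "set p \<subseteq> arcs D"
      using that(1) by (simp add: contains_reduced_loops_def)
    with that(2) show "e \<in> arcs D" by blast
  qed
  ultimately show "contains_reduced_loops G X H (core G X H)"
    unfolding contains_reduced_loops_def by blast
  show "subgraph (core G X H) C" if "contains_reduced_loops G X H C"
    using that wf by (auto simp: core_def contains_reduced_loops_def subgraph_def compatible_def)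
qed


section \<open>Deficit\<close>

text \<open>In \<open>deficit r b C\<close>, \<open>r\<close> is the rank and \<open>b\<close> the distinguished vertex.\<close>

definition graph_dist :: "('v, 'e) pre_digraph \<Rightarrow> 'v \<Rightarrow> 'v \<Rightarrow> nat" where
  "graph_dist C u v = (LEAST n. \<exists>p. pre_digraph.awalk C u p v \<and> length p = n)"

definition vertex_deficit :: "nat \<Rightarrow> ('v, 'e) pre_digraph \<Rightarrow> 'v \<Rightarrow> real" where
  "vertex_deficit r C v = 2 * real r - real (out_degree C v)"

definition deficit :: "nat \<Rightarrow> 'v \<Rightarrow> ('v, 'e) pre_digraph \<Rightarrow> real" where
  "deficit r b C =
     (\<Sum>\<^sub>\<infinity>v \<in> verts C. vertex_deficit r C v / (2 * real r - 1) ^ graph_dist C b v)"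

end

theory Submission
  imports Defs
begin

text \<open>
  Write \<open>o\<close> for the vertex \<open>H\<close>, \<open>g = u c u\<inverse>\<close> with \<open>c\<close> cyclically reduced, and \<open>|v|\<close> for the distance from
  \<open>o\<close> to \<open>v\<close>. Since no power of \<open>g\<close> lies in \<open>H\<close> and the core \<open>C\<close> of \<open>H\<close> is finite, the rays \<open>u c c c \<dots>\<close>
  and \<open>u c\<inverse> c\<inverse> \<dots>\<close> leave \<open>C\<close>, and a reduced path that has left the core never returns. For large \<open>n\<close>
  split the reduced word of \<open>g\<^sup>n\<close> in its middle as \<open>p a p'\<inverse>\<close>. The two arcs \<open>(H p, a)\<close> and \<open>(H p', a\<inverse>)\<close>
  then lie outside \<open>C\<close>, far from \<open>o\<close> and at almost equal distance from it. Ping-pong with the set of elements whose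
  reduced word starts with \<open>p a\<close> or \<open>p' a\<inverse>\<close> shows \<open>H\<^sub>1 = H * \<langle>g\<^sup>n\<rangle>\<close>, and also that near \<open>o\<close> the core of \<open>H\<^sub>1\<close> is
  \<open>C\<close> together with the paths \<open>p\<close> and \<open>p'\<close> and the two exit arcs. Attaching a new edge at a vertex
  \<open>v\<close> costs \<open>(2 r - 1) ^ (- |v|)\<close> in deficit, but its other end contributes
  \<open>(2 r - 1) (2 r - 1) ^ (- |v| - 1)\<close>. So only the two exit arcs cost anything, and they are far away.
\<close>

section \<open>Reduced words and prefixes of subgroup elements\<close>

text \<open>The free group is presented by its symmetric alphabet \<open>S\<close>, whose letters
  are group elements, so that formal and actual inverses agree. \<open>S_inv_neq\<close> excludes
  involutions, which the other assumptions would permit.\<close>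

locale symmetric_free_generators = group G for G (structure) +
  fixes S :: "'a set"
  assumes S_closed: "S \<subseteq> carrier G"
    and S_inv: "a \<in> S \<Longrightarrow> inv a \<in> S"
    and S_inv_neq: "a \<in> S \<Longrightarrow> inv a \<noteq> a"
    and S_gen: "x \<in> carrier G \<Longrightarrow> \<exists>w. set w \<subseteq> S \<and> group_prod G w = x"
    and S_inj: "inj_on (group_prod G) {w. set w \<subseteq> S \<and> successively (\<lambda>a b. b \<noteq> inv a) w}"
begin

abbreviation val :: "'a list \<Rightarrow> 'a" where
  "val \<equiv> group_prod G"

definition rw :: "'a list \<Rightarrow> bool" where
  "rw w \<longleftrightarrow> set w \<subseteq> S \<and> successively (\<lambda>a b. b \<noteq> inv a) w"

definition winv :: "'a list \<Rightarrow> 'a list" where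
  "winv w = rev (map (\<lambda>a. inv a) w)"

definition nf :: "'a \<Rightarrow> 'a list" where
  "nf x = (THE w. rw w \<and> val w = x)"

lemma S_carrier [simp]: "a \<in> S \<Longrightarrow> a \<in> carrier G"
  using S_closed by auto

lemma inv_mult_cancel [simp]:
  assumes "x \<in> carrier G" "y \<in> carrier G"
  shows "inv x \<otimes> (x \<otimes> y) = y" "x \<otimes> (inv x \<otimes> y) = y"
  using assms by (simp_all add: m_assoc[symmetric])

lemma val_Nil [simp]: "val [] = \<one>"
  by (simp add: group_prod_def)

lemma val_Cons [simp]: "val (a # w) = a \<otimes> val w"
  by (simp add: group_prod_def)

lemma val_closed [simp]: "set w \<subseteq> S \<Longrightarrow> val w \<in> carrier G"
  by (induction w) auto

lemma val_append [simp]: "set v \<subseteq> S \<Longrightarrow> set w \<subseteq> S \<Longrightarrow> val (v @ w) = val v \<otimes> val w"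
  by (induction v) (auto simp: m_assoc)

lemma winv_Nil [simp]: "winv [] = []"
  and winv_Cons: "winv (a # w) = winv w @ [inv a]"
  and winv_append [simp]: "winv (v @ w) = winv w @ winv v"
  and length_winv [simp]: "length (winv w) = length w"
  and winv_eq_Nil [simp]: "winv w = [] \<longleftrightarrow> w = []"
  by (auto simp: winv_def)

lemma set_winv [simp]: "set w \<subseteq> S \<Longrightarrow> set (winv w) \<subseteq> S"
  using S_inv by (auto simp: winv_def)

lemma val_winv [simp]: "set w \<subseteq> S \<Longrightarrow> val (winv w) = inv (val w)"
  by (induction w) (auto simp: winv_Cons S_inv inv_mult_group)

lemma winv_winv [simp]: "set w \<subseteq> S \<Longrightarrow> winv (winv w) = w"
  by (induction w) (auto simp: winv_Cons)

lemma rw_set: "rw w \<Longrightarrow> set w \<subseteq> S"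
  by (simp add: rw_def)

lemma rw_Nil [simp]: "rw []"
  by (simp add: rw_def)

lemma rw_single [simp]: "rw [a] \<longleftrightarrow> a \<in> S"
  by (simp add: rw_def)

lemma rw_append:
  "rw (v @ w) \<longleftrightarrow> rw v \<and> rw w \<and> (v = [] \<or> w = [] \<or> hd w \<noteq> inv (last v))"
  by (auto simp: rw_def successively_append_iff)

lemma rw_Cons: "rw (a # w) \<longleftrightarrow> a \<in> S \<and> rw w \<and> (w = [] \<or> hd w \<noteq> inv a)"
  using rw_append[of "[a]" w] by simp

lemma rw_appendD: "rw (v @ w) \<Longrightarrow> rw v" "rw (v @ w) \<Longrightarrow> rw w"
  by (auto simp: rw_append)

text \<open>Being reduced only concerns neighbouring letters, so two reduced words may be glued
  along a non-empty common piece.\<close>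

lemma rw_overlap:
  assumes "rw (u @ v)" "rw (v @ w)" "v \<noteq> []"
  shows "rw (u @ v @ w)"
  using assms by (auto simp: rw_append)

lemma rw_overlap1:
  assumes "rw (u @ [b])" "rw (b # w)"
  shows "rw (u @ b # w)"
  using rw_overlap[of u "[b]" w] assms by simp

lemma rw_winv [simp]: "rw w \<Longrightarrow> rw (winv w)"
proof (induction w)
  case (Cons a w)
  have "rw (winv w)" "a \<in> S" "w = [] \<or> hd w \<noteq> inv a"
    using Cons by (auto simp: rw_Cons)
  moreover have "last (winv w) = inv (hd w)" if "w \<noteq> []"
    using that by (cases w) (auto simp: winv_Cons)
  moreover have "hd w \<in> S" if "w \<noteq> []"
    using that Cons.prems rw_set[of "a # w"] by (cases w) auto
  ultimately show ?case
    by (auto simp: winv_Cons rw_append S_inv)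
qed simp

lemma rw_unique: "rw v \<Longrightarrow> rw w \<Longrightarrow> val v = val w \<Longrightarrow> v = w"
  using S_inj by (auto simp: rw_def inj_on_def)

lemma not_rw_cancel:
  assumes "set w \<subseteq> S" "\<not> rw w"
  obtains u a v where "w = u @ a # inv a # v"
proof -
  have "\<exists>u a v. w = u @ a # inv a # v"
    using assms
  proof (induction w)
    case (Cons b w)
    show ?case
    proof (cases "rw w")
      case True
      then have "w \<noteq> []" "hd w = inv b"
        using Cons.prems by (auto simp: rw_Cons)
      then have "b # w = [] @ b # inv b # tl w"
        by (cases w) auto
      then show ?thesis by blast
    next
      case False
      then obtain u a v where "w = u @ a # inv a # v"
        using Cons by auto
      then have "b # w = (b # u) @ a # inv a # v" by simp
      then show ?thesis by blast
    qed
  qed simp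
  then show ?thesis using that by blast
qed

text \<open>Cancelling inverse pairs shortens the word, so it ends at a reduced one, and any
  property that survives a cancellation is carried along. The property is left open because it also
  has to track the arcs that a word traverses.\<close>

lemma reduced_representative:
  assumes "P w" and S: "\<And>w. P w \<Longrightarrow> set w \<subseteq> S"
    and cancel: "\<And>u a v. P (u @ a # inv a # v) \<Longrightarrow> P (u @ v)"
  obtains v where "P v" "rw v" "length v \<le> length w"
proof -
  have "\<exists>v. P v \<and> rw v \<and> length v \<le> length w"
    using assms(1)
  proof (induction w rule: length_induct)
    case (1 w)
    show ?case
    proof (cases "rw w")
      case False
      then obtain u a v where w: "w = u @ a # inv a # v"
        using not_rw_cancel S 1 by metis
      then have "P (u @ v)" using 1 cancel by blast
      then show ?thesis using 1(1)[rule_format, of "u @ v"] w by auto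
    qed (use 1 in auto)
  qed
  then show ?thesis using that by blast
qed

lemma val_cancel:
  assumes "set (u @ a # inv a # v) \<subseteq> S"
  shows "val (u @ a # inv a # v) = val (u @ v)"
proof -
  have "a \<otimes> (inv a \<otimes> val v) = val v"
    using assms by (simp add: m_assoc[symmetric])
  then show ?thesis
    using assms by simp
qed

lemma nf_props:
  assumes "x \<in> carrier G"
  shows "rw (nf x)" "val (nf x) = x"
proof -
  obtain w where w: "set w \<subseteq> S" "val w = x"
    using S_gen assms by blast
  obtain v where "set v \<subseteq> S \<and> val v = x" "rw v"
  proof (rule reduced_representative[of "\<lambda>w. set w \<subseteq> S \<and> val w = x" w])
    fix u a v assume "set (u @ a # inv a # v) \<subseteq> S \<and> val (u @ a # inv a # v) = x"
    then show "set (u @ v) \<subseteq> S \<and> val (u @ v) = x"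
      using val_cancel by auto
  qed (use w in auto)
  then have "\<exists>!w. rw w \<and> val w = x"
    using rw_unique by blast
  then have "rw (nf x) \<and> val (nf x) = x"
    unfolding nf_def by (rule theI')
  then show "rw (nf x)" "val (nf x) = x" by auto
qed

lemma nf_eqI: "rw w \<Longrightarrow> val w = x \<Longrightarrow> nf x = w"
  using rw_unique nf_props[of x] val_closed rw_set by metis

lemma nf_val: "rw w \<Longrightarrow> nf (val w) = w"
  by (rule nf_eqI) auto

lemma nf_one [simp]: "nf \<one> = []"
  by (rule nf_eqI) auto

lemma set_nf [simp]: "x \<in> carrier G \<Longrightarrow> set (nf x) \<subseteq> S"
  using nf_props rw_set by blast

section \<open>Cosets, and reduced words that begin an element of a subgroup\<close>

lemma rcos_eq_iff:
  assumes "subgroup H G" "x \<in> carrier G" "y \<in> carrier G"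
  shows "H #> x = H #> y \<longleftrightarrow> x \<otimes> inv y \<in> H"
proof
  assume "H #> x = H #> y"
  then have "x \<in> H #> y"
    using rcos_self[OF assms(2,1)] by simp
  then show "x \<otimes> inv y \<in> H"
    using assms by (metis subgroup.rcos_module is_group)
next
  assume "x \<otimes> inv y \<in> H"
  then have "x \<in> H #> y"
    using assms by (metis subgroup.rcos_module is_group)
  then show "H #> x = H #> y"
    using repr_independence assms by metis
qed

text \<open>These words are the initial segments of the reduced loops at \<open>o\<close>, that is,
  the reduced paths from \<open>o\<close> inside the core.\<close>

definition pre :: "'a set \<Rightarrow> 'a list \<Rightarrow> bool" where
  "pre H w \<longleftrightarrow> (\<exists>z. rw (w @ z) \<and> val (w @ z) \<in> H)"

lemma pre_rw: "pre H w \<Longrightarrow> rw w"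
  by (auto simp: pre_def rw_append)

lemma pre_appendD: "pre H (v @ w) \<Longrightarrow> pre H v"
  by (auto simp: pre_def)

lemma pre_Nil: "subgroup H G \<Longrightarrow> pre H []"
  by (auto simp: pre_def subgroup.one_closed intro: exI[of _ "[]"])

lemma pre_mono: "H \<subseteq> H' \<Longrightarrow> pre H w \<Longrightarrow> pre H' w"
  by (auto simp: pre_def)

lemma pre_rwI: "rw (w @ z) \<Longrightarrow> val (w @ z) \<in> H \<Longrightarrow> pre H w"
  by (auto simp: pre_def)

text \<open>Staying in the core depends only on the last arc: a continuation \<open>z\<close> that
  closes up after \<open>q' @ [b]\<close> also closes up after \<open>q @ [b]\<close>, and
  reducedness carries over through the shared letter \<open>b\<close>.\<close>

lemma pre_cong_coset:
  assumes H: "subgroup H G" and q: "rw (q @ [b])" "rw (q' @ [b])" "H #> val q = H #> val q'"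
    and pre: "pre H (q' @ [b])"
  shows "pre H (q @ [b])"
proof -
  obtain z where z: "rw (q' @ b # z)" "val (q' @ b # z) \<in> H"
    using pre by (auto simp: pre_def)
  have S: "set q \<subseteq> S" "set q' \<subseteq> S" "b \<in> S" "set z \<subseteq> S"
    using q z rw_set by (auto simp: rw_def)
  have rw: "rw (q @ b # z)"
    using rw_overlap1 q z by (metis rw_appendD(2))
  have "val (q @ b # z) = (val q \<otimes> inv (val q')) \<otimes> val (q' @ b # z)"
    using S by (simp add: m_assoc inv_solve_left)
  moreover have "val q \<otimes> inv (val q') \<in> H"
    using rcos_eq_iff[OF H] S q by auto
  ultimately have "val (q @ b # z) \<in> H"
    using z subgroup.m_closed[OF H] by metis
  then show ?thesis
    using rw by (auto simp: pre_def)
qed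

text \<open>A reduced path that has left the core never returns to it, so its continuation is
  unaffected by left translation by \<open>H\<close>.\<close>

lemma nf_translate:
  assumes H: "subgroup H G" and h: "h \<in> H"
    and rw: "rw (q @ b # z)" and n: "\<not> pre H (q @ [b])"
  shows "nf (h \<otimes> val (q @ b # z)) = nf (h \<otimes> val q) @ b # z"
    and "rw (nf (h \<otimes> val q) @ b # z)"
proof -
  have S: "set q \<subseteq> S" "b \<in> S" "set z \<subseteq> S"
    using rw rw_set by (auto simp: rw_def)
  have hc: "h \<in> carrier G" using subgroup.mem_carrier[OF H] h by auto
  define y where "y = nf (h \<otimes> val q)"
  have y: "rw y" "val y = h \<otimes> val q" "set y \<subseteq> S"
    using nf_props hc S by (auto simp: y_def)
  have qb: "rw (q @ [b])" "rw (b # z)"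
    using rw by (auto simp: rw_append rw_Cons)
  \<comment> \<open>If \<open>y\<close> ended in \<open>inv b\<close>, then \<open>y\<close>
    followed by the inverse of \<open>q\<close> would be a reduced word for \<open>h\<close>. The
    inverse of that word starts with \<open>q @ [b]\<close> and represents \<open>inv h\<close>,
    against \<open>n\<close>.\<close>
  have "last y \<noteq> inv b" if "y \<noteq> []"
  proof
    assume "last y = inv b"
    then obtain y1 where y1: "y = y1 @ [inv b]"
      using append_butlast_last_id[OF \<open>y \<noteq> []\<close>] by metis
    have "rw (inv b # winv q)"
      using rw_winv[OF qb(1)] by (simp add: winv_Cons)
    then have rwy: "rw (y1 @ inv b # winv q)"
      using y y1 rw_overlap1 by blast
    have "val (y1 @ inv b # winv q) = val y \<otimes> inv (val q)"
      using y(3) S by (simp add: y1 m_assoc)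
    also have "\<dots> = h"
      using y S hc by (simp add: m_assoc)
    finally have "val (winv (y1 @ inv b # winv q)) = inv h"
      using rwy rw_set val_winv by metis
    moreover have "winv (y1 @ inv b # winv q) = q @ b # winv y1"
      using S y y1 by (simp add: winv_Cons)
    moreover have "rw (q @ b # winv y1)"
      using rw_winv[OF rwy] calculation by simp
    ultimately have "pre H (q @ [b])"
      using subgroup.m_inv_closed[OF H h] by (auto simp: pre_def)
    then show False using n by simp
  qed
  then have rwy: "rw (y @ b # z)"
  proof (cases "y = []")
    case False
    then have "last y \<in> S"
      using y(3) last_in_set by blast
    then have "b \<noteq> inv (last y)"
      using \<open>y \<noteq> [] \<Longrightarrow> last y \<noteq> inv b\<close>[OF False] by auto
    then show ?thesis
      using y(1) qb(2) by (simp add: rw_append)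
  qed (use qb in simp)
  then show "rw (nf (h \<otimes> val q) @ b # z)"
    by (simp add: y_def)
  have "val (y @ b # z) = h \<otimes> val (q @ b # z)"
    using S y hc by (simp add: m_assoc)
  from nf_eqI[OF rwy this] show "nf (h \<otimes> val (q @ b # z)) = nf (h \<otimes> val q) @ b # z"
    unfolding y_def .
qed

text \<open>Two representatives of a coset differ by a left factor from \<open>H\<close>, and by
  \<open>nf_translate\<close> such a factor only rewrites the part \<open>q\<close> before the exit.
  Hence every reduced path to a vertex outside the core leaves through the same arc and ends in the
  same way.\<close>

lemma coset_rep_outside:
  assumes H: "subgroup H G" and rw: "rw (q @ b # z)" "rw y"
    and n: "\<not> pre H (q @ [b])" and eq: "H #> val y = H #> val (q @ b # z)"
  obtains q' where "y = q' @ b # z" "H #> val q' = H #> val q"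
proof -
  have S: "set q \<subseteq> S" "b \<in> S" "set z \<subseteq> S" "set y \<subseteq> S"
    using rw rw_set by (auto simp: rw_def)
  define h where "h = val y \<otimes> inv (val (q @ b # z))"
  have h: "h \<in> H"
    using eq rcos_eq_iff[OF H] S by (simp add: h_def)
  have hc: "h \<in> carrier G"
    using S by (auto simp: h_def)
  have "h \<otimes> val (q @ b # z) = val y"
    unfolding h_def using S by (simp add: m_assoc)
  then have y: "y = nf (h \<otimes> val q) @ b # z"
    using nf_translate[OF H h rw(1) n] nf_val[OF rw(2)] by simp
  moreover have "H #> val (nf (h \<otimes> val q)) = H #> val q"
    using rcos_eq_iff[OF H] h hc S nf_props by (simp add: m_assoc)
  ultimately show ?thesis using that by blast
qed

section \<open>The core in terms of reduced words\<close>

definition core_verts :: "'a set \<Rightarrow> 'a set set" where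
  "core_verts H = {H #> val q | q. pre H q}"

definition core_arcs :: "'a set \<Rightarrow> ('a set \<times> 'a) set" where
  "core_arcs H = {(H #> val q, b) | q b. pre H (q @ [b])}"

text \<open>This is the distance from \<open>o\<close> in the whole Cayley graph of the cosets of
  \<open>H\<close>. Admitting all words, reduced or not, makes upper bounds immediate.\<close>

definition dst :: "'a set \<Rightarrow> 'a set \<Rightarrow> nat" where
  "dst H v = (LEAST n. \<exists>w. set w \<subseteq> S \<and> length w = n \<and> H #> val w = v)"

lemma rcos_mult:
  "subgroup H G \<Longrightarrow> x \<in> carrier G \<Longrightarrow> y \<in> carrier G \<Longrightarrow> H #> x #> y = H #> (x \<otimes> y)"
  using coset_mult_assoc subgroup.subset by blast

lemma rcos_val_snoc:
  "subgroup H G \<Longrightarrow> set q \<subseteq> S \<Longrightarrow> b \<in> S \<Longrightarrow> H #> val q #> b = H #> val (q @ [b])"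
  by (simp add: rcos_mult)

lemma rcos_one [simp]: "subgroup H G \<Longrightarrow> H #> \<one> = H"
  using coset_mult_one subgroup.subset by blast

lemma rcos_eq_self: "subgroup H G \<Longrightarrow> x \<in> carrier G \<Longrightarrow> H #> x = H \<longleftrightarrow> x \<in> H"
  using rcos_eq_iff[of H x \<one>] by simp

lemma core_vertsI: "pre H q \<Longrightarrow> H #> val q \<in> core_verts H"
  by (auto simp: core_verts_def)

lemma core_arcsI: "pre H (q @ [b]) \<Longrightarrow> (H #> val q, b) \<in> core_arcs H"
  by (auto simp: core_arcs_def)

lemma core_arcsE:
  assumes "e \<in> core_arcs H"
  obtains q b z where "e = (H #> val q, b)" "rw (q @ b # z)" "val (q @ b # z) \<in> H"
    "set q \<subseteq> S" "b \<in> S" "set z \<subseteq> S"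
proof -
  obtain q b z where *: "e = (H #> val q, b)" "rw (q @ b # z)" "val (q @ b # z) \<in> H"
    using assms by (auto simp: core_arcs_def pre_def)
  then show ?thesis using that[OF *] rw_set[OF *(2)] by simp
qed

lemma core_arcs_pre:
  assumes H: "subgroup H G" and "rw (q @ [b])" and "(H #> val q, b) \<in> core_arcs H"
  shows "pre H (q @ [b])"
proof -
  obtain q' where "H #> val q = H #> val q'" "pre H (q' @ [b])"
    using assms(3) by (auto simp: core_arcs_def)
  then show ?thesis
    using pre_cong_coset[OF H assms(2)] pre_rw by blast
qed

text \<open>A reduced loop through the arc, read backwards, is a reduced loop through the inverse
  arc.\<close>

lemma core_arcs_inverse:
  assumes H: "subgroup H G" and e: "e \<in> core_arcs H"
  shows "inverse_arc G e \<in> core_arcs H"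
proof -
  obtain q b z where *: "e = (H #> val q, b)" "rw (q @ b # z)" "val (q @ b # z) \<in> H"
    "set q \<subseteq> S" "b \<in> S" "set z \<subseteq> S"
    using e by (rule core_arcsE)
  have "rw (winv z @ inv b # winv q)"
    using rw_winv[OF *(2)] by (simp add: winv_Cons)
  moreover have "val (winv z @ inv b # winv q) = inv (val (q @ b # z))"
    using * by (simp add: S_inv inv_mult_group m_assoc)
  ultimately have "pre H (winv z @ [inv b])"
    using *(3) subgroup.m_inv_closed[OF H] by (auto simp: pre_def)
  then have "(H #> val (winv z), inv b) \<in> core_arcs H"
    by (rule core_arcsI)
  moreover have "H #> val (winv z) = H #> val (q @ [b])"
  proof (subst eq_commute, subst rcos_eq_iff[OF H])
    show "val (q @ [b]) \<otimes> inv (val (winv z)) \<in> H"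
      using * by (simp add: m_assoc)
  qed (use * in auto)
  ultimately show ?thesis
    using * rcos_val_snoc[OF H] by (simp add: inverse_arc_def)
qed

lemma core_arcs_ends:
  assumes H: "subgroup H G" and e: "(v, b) \<in> core_arcs H"
  shows "v \<in> core_verts H" "v #> b \<in> core_verts H" "b \<in> S"
proof -
  obtain q z where *: "v = H #> val q" "rw (q @ b # z)" "val (q @ b # z) \<in> H"
    "set q \<subseteq> S" "b \<in> S" "set z \<subseteq> S"
    using e by (rule core_arcsE) auto
  then have "pre H (q @ [b])" "b \<in> S"
    by (auto simp: pre_def)
  then show "v \<in> core_verts H" "v #> b \<in> core_verts H" "b \<in> S"
    using * core_vertsI pre_appendD rcos_val_snoc[OF H, of q b] by metis+
qed

lemma core_verts_base: "subgroup H G \<Longrightarrow> H \<in> core_verts H"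
  using core_vertsI[OF pre_Nil] by fastforce

section \<open>Walks in the Cayley graph as words of labels\<close>

primrec trail :: "'a set \<Rightarrow> 'a list \<Rightarrow> ('a set \<times> 'a) list" where
  "trail s [] = []"
| "trail s (a # w) = (s, a) # trail (s #> a) w"

lemma map_snd_trail [simp]: "map snd (trail s w) = w"
  by (induction w arbitrary: s) auto

lemma length_trail [simp]: "length (trail s w) = length w"
  by (induction w arbitrary: s) auto

lemma set_trail:
  assumes H: "subgroup H G" and "set q \<subseteq> S" "set w \<subseteq> S"
  shows "set (trail (H #> val q) w) = {(H #> val (q @ w1), b) | w1 b w2. w = w1 @ b # w2}"
  using assms(2,3)
proof (induction w arbitrary: q)
  case (Cons a w)
  have IH: "set (trail (H #> val q #> a) w) =
      {(H #> val ((q @ [a]) @ w1), b) | w1 b w2. w = w1 @ b # w2}"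
    using Cons.IH[of "q @ [a]"] Cons.prems rcos_val_snoc[OF H, of q a] by simp
  show ?case
    unfolding trail.simps list.set IH
  proof (intro equalityI subsetI)
    fix e assume "e \<in> insert (H #> val q, a)
      {(H #> val ((q @ [a]) @ w1), b) | w1 b w2. w = w1 @ b # w2}"
    then consider "e = (H #> val q, a)"
      | w1 b w2 where "e = (H #> val ((q @ [a]) @ w1), b)" "w = w1 @ b # w2"
      by blast
    then show "e \<in> {(H #> val (q @ w1), b) | w1 b w2. a # w = w1 @ b # w2}"
    proof cases
      case 1
      then have "e = (H #> val (q @ []), a) \<and> a # w = [] @ a # w"
        by simp
      then show ?thesis by blast
    next
      case (2 w1 b w2)
      then have "e = (H #> val (q @ (a # w1)), b) \<and> a # w = (a # w1) @ b # w2"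
        by simp
      then show ?thesis by blast
    qed
  next
    fix e assume "e \<in> {(H #> val (q @ w1), b) | w1 b w2. a # w = w1 @ b # w2}"
    then obtain w1 b w2 where e: "e = (H #> val (q @ w1), b)" "a # w = w1 @ b # w2"
      by blast
    then show "e \<in> insert (H #> val q, a)
      {(H #> val ((q @ [a]) @ w1), b) | w1 b w2. w = w1 @ b # w2}"
      by (cases w1) auto
  qed
qed simp

lemma set_trail_base:
  assumes H: "subgroup H G" and "set w \<subseteq> S"
  shows "set (trail H w) = {(H #> val q, b) | q b z. w = q @ b # z}"
  using set_trail[OF H, of "[]" w] assms by simp

lemma reduced_path_trail:
  "reduced_path G (trail s w) \<longleftrightarrow> successively (\<lambda>a b. b \<noteq> inv a) w"
proof (induction w arbitrary: s)
  case (Cons a w)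
  then show ?case
    by (cases w) (auto simp: reduced_path_def inverse_arc_def)
qed (simp add: reduced_path_def)

text \<open>Each vertex has exactly one arc with a given label, so a walk is determined by its
  source and its labels. Only \<open>tail\<close> and \<open>head\<close> are prescribed, so that
  this applies to the Cayley graph and to the core alike.\<close>

lemma cas_trail:
  assumes "tail C = fst" "head C = (\<lambda>(s, a). s #> a)" and H: "subgroup H G"
    and "set q \<subseteq> S" "snd ` set p \<subseteq> S"
  shows "pre_digraph.cas C (H #> val q) p v \<longleftrightarrow>
    p = trail (H #> val q) (map snd p) \<and> v = H #> val (q @ map snd p)"
  using assms(4,5)
proof (induction p arbitrary: q)
  case Nil
  then show ?case by (auto simp: pre_digraph.cas.simps)
next
  case (Cons e p)
  obtain s a where e: "e = (s, a)" by (cases e)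
  have S: "set q \<subseteq> S" "a \<in> S" "snd ` set p \<subseteq> S"
    using Cons.prems e by auto
  have "H #> val q #> a = H #> val (q @ [a])"
    using rcos_val_snoc[OF H] S by blast
  then show ?case
    using Cons.IH[of "q @ [a]"] S e assms(1,2)
    by (auto simp: pre_digraph.cas.simps)
qed

text \<open>Reduction never lengthens a word and keeps its value, so a shortest representative may
  be taken reduced.\<close>

lemma least_word:
  assumes H: "subgroup H G" and "x \<in> carrier G"
  obtains w where "rw w" "H #> val w = H #> x" "length w = dst H (H #> x)"
proof -
  let ?P = "\<lambda>n. \<exists>w. set w \<subseteq> S \<and> length w = n \<and> H #> val w = H #> x"
  have "?P (length (nf x))"
    using nf_props set_nf assms by metis
  then have "?P (dst H (H #> x))"
    unfolding dst_def by (rule LeastI)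
  then obtain w where w: "set w \<subseteq> S" "length w = dst H (H #> x)" "H #> val w = H #> x"
    by blast
  obtain v where v: "set v \<subseteq> S \<and> val v = val w" "rw v" "length v \<le> length w"
  proof (rule reduced_representative[of "\<lambda>v. set v \<subseteq> S \<and> val v = val w" w])
    fix u a v assume "set (u @ a # inv a # v) \<subseteq> S \<and> val (u @ a # inv a # v) = val w"
    then show "set (u @ v) \<subseteq> S \<and> val (u @ v) = val w"
      using val_cancel by auto
  qed (use w in auto)
  have "dst H (H #> x) \<le> length v"
    unfolding dst_def by (rule Least_le) (use v w in auto)
  then show ?thesis
    using that[of v] v w by auto
qed

lemma dst_le: "set w \<subseteq> S \<Longrightarrow> dst H (H #> val w) \<le> length w"
  unfolding dst_def by (rule Least_le) auto

lemma dst_base: "subgroup H G \<Longrightarrow> dst H H = 0"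
  using dst_le[of "[]" H] by simp

text \<open>A geodesic from \<open>o\<close> to a core vertex \<open>v\<close> cannot cancel against both of the two distinct core
  edges at \<open>v\<close> used by a reduced loop through \<open>v\<close>.\<close>

lemma pre_geodesic:
  assumes H: "subgroup H G" and v: "H #> val p \<in> core_verts H" and p: "rw p"
    and len: "length p = dst H (H #> val p)"
  shows "pre H p"
proof -
  obtain q z where qz: "H #> val p = H #> val q" "rw (q @ z)" "val (q @ z) \<in> H"
    using v by (auto simp: core_verts_def pre_def)
  have S: "set p \<subseteq> S" "set q \<subseteq> S" "set z \<subseteq> S"
    using p qz rw_set[of "q @ z"] rw_set[of p] by auto
  have pq: "val p \<otimes> inv (val q) \<in> H"
    using qz(1) rcos_eq_iff[OF H] S by simp
  have pz: "val (p @ z) \<in> H"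
  proof -
    have "(val p \<otimes> inv (val q)) \<otimes> val (q @ z) = val (p @ z)"
      using S by (simp add: m_assoc)
    then show ?thesis
      using subgroup.m_closed[OF H pq qz(3)] by simp
  qed
  show ?thesis
  proof (cases "rw (p @ z)")
    case True
    then show ?thesis using pz by (auto simp: pre_def)
  next
    case False
    then have ne: "p \<noteq> []" "z \<noteq> []" "hd z = inv (last p)"
      using p qz(2) by (auto simp: rw_append)
    show ?thesis
    proof (cases "q = []")
      case True
      then have "H #> val p = H"
        using qz(1) H by simp
      then have "length p = 0" using len dst_base[OF H] by simp
      then show ?thesis using ne by simp
    next
      case False
      \<comment> \<open>As \<open>p\<close> cancels against \<open>z\<close> while \<open>q\<close>
        does not, their last letters differ. So \<open>p\<close> can be continued without
        cancellation along the inverse of \<open>q\<close>, back to \<open>o\<close>.\<close>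
      then have "hd z \<noteq> inv (last q)"
        using qz(2) ne by (auto simp: rw_append)
      then have "last p \<noteq> last q" using ne by auto
      have "last p \<in> S" "last q \<in> S"
        using S ne False last_in_set by blast+
      have "hd (winv q) = inv (last q)"
        using False by (metis append_Cons append_butlast_last_id append_self_conv2 list.sel(1) winv_Cons winv_Nil winv_append)
      also have "\<dots> \<noteq> inv (last p)"
        using \<open>last p \<noteq> last q\<close> \<open>last p \<in> S\<close> \<open>last q \<in> S\<close> inv_inj by (metis S_carrier inv_inv)
      finally have "rw (p @ winv q)"
        using p qz(2) by (auto simp: rw_append)
      moreover have "val (p @ winv q) \<in> H"
        using pq S by simp
      ultimately show ?thesis by (auto simp: pre_def)
    qed
  qed
qed

text \<open>Every element of \<open>H\<close> is spelled by a product of generators, possibly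
  unreduced, that stays on the finitely many arcs of the generator loops. Cancellation only discards
  arcs, so the reduced loops stay there too.\<close>

lemma finite_core:
  assumes fT: "finite T" and T: "T \<subseteq> carrier G" and HT: "H = generate G T"
  shows "finite (core_arcs H)" "finite (core_verts H)"
proof -
  have H: "subgroup H G"
    using HT T generate_is_subgroup by simp
  define E where "E = (\<Union>x \<in> T. set (trail H (nf x)) \<union> set (trail H (nf (inv x))))"
  have finE: "finite E"
    using fT by (auto simp: E_def)
  have ex: "\<exists>w. set w \<subseteq> S \<and> val w = h \<and> set (trail H w) \<subseteq> E" if "h \<in> generate G T" for h
    using that
  proof (induction rule: generate.induct)
    case one
    then show ?case by (intro exI[of _ "[]"]) auto
  next
    case (incl h)
    then have "h \<in> carrier G" "set (trail H (nf h)) \<subseteq> E"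
      using T by (auto simp: E_def)
    then show ?case
      using set_nf nf_props(2) by blast
  next
    case (inv h)
    then have "inv h \<in> carrier G" "set (trail H (nf (inv h))) \<subseteq> E"
      using T by (auto simp: E_def)
    then show ?case
      using set_nf nf_props(2) by blast
  next
    case (eng h1 h2)
    then obtain w1 w2 where w: "set w1 \<subseteq> S" "val w1 = h1" "set (trail H w1) \<subseteq> E"
        "set w2 \<subseteq> S" "val w2 = h2" "set (trail H w2) \<subseteq> E"
      by blast
    have "h1 \<in> H" using eng HT by simp
    then have "H #> h1 = H" using rcos_eq_self[OF H, of h1] w(1,2) val_closed by metis
    \<comment> \<open>The first factor lies in \<open>H\<close> and hence is a loop, so the trail of
      the second factor starts at \<open>o\<close> again.\<close>
    have "trail s (w1 @ w2) = trail s w1 @ trail (foldl (#>) s w1) w2" for s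
      by (induction w1 arbitrary: s) auto
    moreover have "foldl (#>) (H #> val u) v = H #> val (u @ v)"
      if "set u \<subseteq> S" "set v \<subseteq> S" for u v
      using that
    proof (induction v arbitrary: u)
      case (Cons a v)
      then show ?case using Cons.IH[of "u @ [a]"] rcos_val_snoc[OF H, of u a] by simp
    qed simp
    from this[of "[]" w1] have "foldl (#>) H w1 = H"
      using w H \<open>H #> h1 = H\<close> by simp
    ultimately have "set (trail H (w1 @ w2)) \<subseteq> E"
      using w by simp
    then show ?case
      using w by (intro exI[of _ "w1 @ w2"]) auto
  qed
  have "core_arcs H \<subseteq> E"
  proof
    fix e assume "e \<in> core_arcs H"
    then obtain q b z where *: "e = (H #> val q, b)" "rw (q @ b # z)" "val (q @ b # z) \<in> H"
      by (rule core_arcsE)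
    define h where "h = val (q @ b # z)"
    obtain w where w: "set w \<subseteq> S \<and> val w = h \<and> set (trail H w) \<subseteq> E"
      using ex * h_def HT by blast
    obtain v where v: "set v \<subseteq> S \<and> val v = h \<and> set (trail H v) \<subseteq> E" "rw v"
    proof (rule reduced_representative[of "\<lambda>w. set w \<subseteq> S \<and> val w = h \<and> set (trail H w) \<subseteq> E" w])
      fix u a v
      assume A: "set (u @ a # inv a # v) \<subseteq> S \<and> val (u @ a # inv a # v) = h \<and>
        set (trail H (u @ a # inv a # v)) \<subseteq> E"
      then have S: "set u \<subseteq> S" "a \<in> S" "inv a \<in> S" "set v \<subseteq> S"
        by auto
      \<comment> \<open>A backtrack \<open>a\<close>, \<open>inv a\<close> returns to the vertex
        where it began, so the arcs of \<open>v\<close> are unchanged by its removal.\<close>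
      have "set (trail H (u @ v)) \<subseteq> set (trail H (u @ a # inv a # v))"
      proof
        fix e assume "e \<in> set (trail H (u @ v))"
        then obtain q b z where e: "e = (H #> val q, b)" "u @ v = q @ b # z"
          using set_trail_base[OF H] S by auto
        show "e \<in> set (trail H (u @ a # inv a # v))"
        proof -
          consider y where "u = q @ b # y" | y where "q = u @ y" "v = y @ b # z"
            using e(2) by (auto simp: append_eq_append_conv2 append_eq_Cons_conv Cons_eq_append_conv)
          then show ?thesis
          proof cases
            case (1 y)
            then have "u @ a # inv a # v = q @ b # (y @ a # inv a # v)" by simp
            moreover have "set (u @ a # inv a # v) \<subseteq> S" using A by blast
            ultimately show ?thesis
              unfolding e using set_trail_base[OF H, of "u @ a # inv a # v"] by blast
          next
            case (2 y)
            then have "u @ a # inv a # v = (u @ a # inv a # y) @ b # z" by simp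
            moreover have "val (u @ a # inv a # y) = val q"
              using 2 S val_cancel by auto
            moreover have "set (u @ a # inv a # v) \<subseteq> S" using A by blast
            moreover have "(H #> val (u @ a # inv a # y), b) \<in> set (trail H (u @ a # inv a # v))"
              using set_trail_base[OF H, of "u @ a # inv a # v"] calculation by blast
            ultimately show ?thesis
              unfolding e by simp
          qed
        qed
      qed
      then show "set (u @ v) \<subseteq> S \<and> val (u @ v) = h \<and> set (trail H (u @ v)) \<subseteq> E"
        using A val_cancel[of u a v] by auto
    qed (use w in auto)
    have "v = q @ b # z"
      using rw_unique[OF v(2) *(2)] v(1) h_def by simp
    then show "e \<in> E"
      using v(1) * set_trail_base[OF H, of v] by blast
  qed
  then show fa: "finite (core_arcs H)"
    by (rule finite_subset) (rule finE)
  have "core_verts H \<subseteq> insert H ((\<lambda>(s, a). s #> a) ` core_arcs H)"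
  proof
    fix v assume "v \<in> core_verts H"
    then obtain q where q: "v = H #> val q" "pre H q"
      by (auto simp: core_verts_def)
    show "v \<in> insert H ((\<lambda>(s, a). s #> a) ` core_arcs H)"
    proof (cases q rule: rev_cases)
      case Nil
      then show ?thesis using q H by simp
    next
      case (snoc q1 b)
      then have e: "(H #> val q1, b) \<in> core_arcs H" "set q1 \<subseteq> S" "b \<in> S"
        using q core_arcsI pre_rw rw_set[of q] by auto
      have "v = (\<lambda>(s, a). s #> a) (H #> val q1, b)"
        using rcos_val_snoc[OF H e(2,3)] q(1) snoc by simp
      then show ?thesis
        using e(1) by blast
    qed
  qed
  then show "finite (core_verts H)"
    by (rule finite_subset) (use fa in simp)
qed

end

section \<open>The core as a graph, and its deficit, in terms of words\<close>

locale cayley_letters = symmetric_free_generators +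
  fixes X :: "'a set" and r :: nat
  assumes letters: "sym_letters G X = S"
    and fin_S: "finite S" and card_S: "card S = 2 * r" and rank: "r > 1"
begin

lemma X_closed: "X \<subseteq> carrier G"
  using letters S_closed by (auto simp: sym_letters_def)

text \<open>The graph given by words contains all reduced loops, so the least such graph lies inside
  it. Conversely, each of its arcs occurs on the reduced loop read off \<open>q @ b # z\<close>, and
  each of its vertices is \<open>o\<close> or the head of such an arc.\<close>

lemma core_eq:
  assumes H: "subgroup H G"
  shows "core G X H =
    \<lparr>verts = core_verts H, arcs = core_arcs H, tail = fst, head = (\<lambda>(s, a). s #> a)\<rparr>"
    (is "_ = ?C")
proof -
  have cg: "verts (cayley_graph G X H) = rcosets H" "arcs (cayley_graph G X H) = (rcosets H) \<times> S"
    "tail (cayley_graph G X H) = fst" "head (cayley_graph G X H) = (\<lambda>(s, a). s #> a)"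
    using letters by (auto simp: cayley_graph_def)
  have sub: "core_verts H \<subseteq> rcosets H"
    using pre_rw rw_set val_closed by (fastforce simp: core_verts_def RCOSETS_def)
  have "wf_digraph ?C"
    by unfold_locales (use core_arcs_ends[OF H] in auto)
  then have "subgraph ?C (cayley_graph G X H)"
    using sub core_arcs_ends[OF H] cg wf_cayley_graph[OF X_closed H]
    by (auto simp: subgraph_def compatible_def)
  moreover have "inverse_arc G ` arcs ?C \<subseteq> arcs ?C"
    using core_arcs_inverse[OF H] by auto
  moreover have "set p \<subseteq> core_arcs H" if "p \<in> reduced_loops G X H" for p
  proof -
    have p: "set p \<subseteq> (rcosets H) \<times> S" "pre_digraph.cas (cayley_graph G X H) H p H"
      "reduced_path G p"
      using that cg by (auto simp: reduced_loops_def pre_digraph.awalk_def)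
    then have S: "set (map snd p) \<subseteq> S" "snd ` set p \<subseteq> S" by auto
    have w: "p = trail H (map snd p)" "H = H #> val (map snd p)"
      using cas_trail[OF cg(3,4) H, of "[]" p H] p(2) S H by auto
    have "rw (map snd p)"
      using p(3) w(1) reduced_path_trail[of H "map snd p"] S(1) by (simp add: rw_def)
    moreover have "val (map snd p) \<in> H"
      using w(2) rcos_eq_self[OF H val_closed[OF S(1)]] by simp
    ultimately have sub: "e \<in> core_arcs H" if e: "e \<in> set (trail H (map snd p))" for e
    proof -
      obtain q b z where "e = (H #> val q, b)" "map snd p = q @ b # z"
        using e set_trail_base[OF H S(1)] by blast
      then show ?thesis
        using \<open>rw (map snd p)\<close> \<open>val (map snd p) \<in> H\<close> by (auto intro!: core_arcsI simp: pre_def)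
    qed
    have "set p = set (trail H (map snd p))"
      by (rule arg_cong[where f = set, OF w(1)])
    with sub show ?thesis by blast
  qed
  ultimately have C: "contains_reduced_loops G X H ?C"
    using core_verts_base[OF H] by (auto simp: contains_reduced_loops_def)
  have le: "verts (core G X H) \<subseteq> core_verts H" "arcs (core G X H) \<subseteq> core_arcs H"
    using core_least(2)[OF X_closed H C] by (auto simp: subgraph_def)
  have least: "contains_reduced_loops G X H (core G X H)"
    by (rule core_least(1)[OF X_closed H])
  have ge: "core_arcs H \<subseteq> arcs (core G X H)"
  proof
    fix e assume "e \<in> core_arcs H"
    then obtain q b z where *: "e = (H #> val q, b)" "rw (q @ b # z)" "val (q @ b # z) \<in> H"
      by (rule core_arcsE)
    let ?w = "q @ b # z"
    have S: "set ?w \<subseteq> S" using * rw_set by blast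
    have tr: "set (trail H ?w) = {(H #> val q', b') | q' b' z'. ?w = q' @ b' # z'}"
      by (rule set_trail_base[OF H S])
    have "set (trail H ?w) \<subseteq> (rcosets H) \<times> S"
    proof
      fix f assume "f \<in> set (trail H ?w)"
      then obtain q' b' z' where f: "f = (H #> val q', b')" "?w = q' @ b' # z'"
        using tr by blast
      then have "set q' \<subseteq> S" "b' \<in> S"
        using S by auto
      then show "f \<in> (rcosets H) \<times> S"
        using f(1) val_closed by (auto simp: RCOSETS_def)
    qed
    moreover have "pre_digraph.cas (cayley_graph G X H) (H #> val []) (trail H ?w) H"
      using cas_trail[OF cg(3,4) H, of "[]" "trail H ?w" H] S H
        rcos_eq_self[OF H val_closed[OF S]] *(3)
      by (auto simp: map_snd_trail image_iff simp flip: set_map)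
    moreover have "H \<in> rcosets H"
      using sub core_verts_base[OF H] by auto
    moreover have "reduced_path G (trail H ?w)"
      using *(2) reduced_path_trail by (auto simp: rw_def)
    ultimately have "trail H ?w \<in> reduced_loops G X H"
      using H cg by (auto simp: reduced_loops_def pre_digraph.awalk_def)
    then have "set (trail H ?w) \<subseteq> arcs (core G X H)"
      using least by (auto simp: contains_reduced_loops_def)
    moreover have "e \<in> set (trail H ?w)"
      using tr * by blast
    ultimately show "e \<in> arcs (core G X H)" by blast
  qed
  have th: "tail (core G X H) = fst" "head (core G X H) = (\<lambda>(s, a). s #> a)"
    using cg by (auto simp: core_def)
  have wf: "wf_digraph (core G X H)" and base: "H \<in> verts (core G X H)"
    using least by (auto simp: contains_reduced_loops_def subgraph_def)
  have "core_verts H \<subseteq> verts (core G X H)"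
  proof
    fix v assume "v \<in> core_verts H"
    then obtain q where q: "v = H #> val q" "pre H q"
      by (auto simp: core_verts_def)
    show "v \<in> verts (core G X H)"
    proof (cases q rule: rev_cases)
      case Nil
      then show ?thesis using q H base by simp
    next
      case (snoc q1 b)
      then have e: "(H #> val q1, b) \<in> arcs (core G X H)" "set q1 \<subseteq> S" "b \<in> S"
        using q core_arcsI ge pre_rw rw_set[of q] by auto
      then show ?thesis
        using wf_digraph.head_in_verts[OF wf e(1)] th rcos_val_snoc[OF H, of q1 b] q snoc
        by simp
    qed
  qed
  then show ?thesis
    using le ge th by (intro pre_digraph.equality) auto
qed

text \<open>By \<open>pre_geodesic\<close> a reduced shortest word to a core vertex traces a path
  inside the core, so restricting to the core does not increase distances. They cannot decrease,
  since every walk in the core spells a word.\<close>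

lemma graph_dist_core:
  assumes H: "subgroup H G" and v: "v \<in> core_verts H"
  shows "graph_dist (core G X H) H v = dst H v"
proof -
  define C where "C = core G X H"
  have C: "verts C = core_verts H" "arcs C = core_arcs H" "tail C = fst"
    "head C = (\<lambda>(s, a). s #> a)"
    using core_eq[OF H] by (auto simp: C_def)
  obtain p where "v = H #> val p" "pre H p"
    using v by (auto simp: core_verts_def)
  then obtain w where w: "rw w" "H #> val w = v" "length w = dst H v"
    using least_word[OF H, of "val p"] pre_rw rw_set val_closed by metis
  have pre: "pre H w"
    using pre_geodesic[OF H _ w(1)] w v by simp
  have S: "set w \<subseteq> S" using w rw_set by blast
  have sub: "set (trail H w) \<subseteq> core_arcs H"
  proof
    fix e assume "e \<in> set (trail H w)"
    then obtain q b z where "e = (H #> val q, b)" "w = q @ b # z"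
      using set_trail_base[OF H S] by blast
    then show "e \<in> core_arcs H"
      using pre pre_appendD[of H "q @ [b]" z] core_arcsI by simp
  qed
  have "pre_digraph.cas C (H #> val []) (trail H w) v"
    using cas_trail[OF C(3,4) H, of "[]" "trail H w" v] S w H
    by (auto simp: map_snd_trail simp flip: set_map)
  then have "pre_digraph.awalk C H (trail H w) v"
    using sub C core_verts_base[OF H] H by (simp add: pre_digraph.awalk_def)
  moreover have "dst H v \<le> length p" if "pre_digraph.awalk C H p v" for p
  proof -
    have p: "set p \<subseteq> core_arcs H" "pre_digraph.cas C (H #> val []) p v"
      using that C H by (auto simp: pre_digraph.awalk_def)
    have S: "snd ` set p \<subseteq> S"
      using p core_arcs_ends(3)[OF H] by force
    then have "v = H #> val (map snd p)"
      using cas_trail[OF C(3,4) H, of "[]" p v] p by simp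
    then show ?thesis
      using dst_le[of "map snd p" H] S by simp
  qed
  ultimately show ?thesis
    unfolding graph_dist_def C_def[symmetric] using w(3)
    by (intro Least_equality) (auto intro!: exI[of _ "trail H w"])
qed

lemma vertex_deficit_core:
  assumes H: "subgroup H G"
  shows "vertex_deficit r (core G X H) v = real (card {b \<in> S. (v, b) \<notin> core_arcs H})"
proof -
  have "out_arcs (core G X H) v = Pair v ` {b \<in> S. (v, b) \<in> core_arcs H}"
    using core_eq[OF H] core_arcs_ends(3)[OF H] by (auto simp: out_arcs_def)
  then have "out_degree (core G X H) v = card {b \<in> S. (v, b) \<in> core_arcs H}"
    by (simp add: out_degree_def card_image inj_on_def)
  moreover have "card {b \<in> S. (v, b) \<in> core_arcs H} + card {b \<in> S. (v, b) \<notin> core_arcs H} = 2 * r"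
    unfolding card_S[symmetric] using fin_S
    by (subst card_Un_disjoint[symmetric]) (auto intro!: arg_cong[where f = card])
  ultimately show ?thesis
    unfolding vertex_deficit_def by linarith
qed

lemma deficit_core:
  assumes H: "subgroup H G" and fin: "finite (core_verts H)"
  shows "deficit r H (core G X H) =
    (\<Sum>v\<in>core_verts H. real (card {b \<in> S. (v, b) \<notin> core_arcs H}) / (2 * real r - 1) ^ dst H v)"
proof -
  have "verts (core G X H) = core_verts H"
    using core_eq[OF H] by simp
  then show ?thesis
    unfolding deficit_def using fin vertex_deficit_core[OF H] graph_dist_core[OF H]
    by simp
qed

end

section \<open>Ping-pong at two exits from the core\<close>

context symmetric_free_generators
begin

text \<open>Appending \<open>b # z\<close> to a shortest word for \<open>H #> val q\<close> gives
  the upper bound. For the lower one, any shortest word to the endpoint ends in \<open>b # z\<close>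
  by \<open>coset_rep_outside\<close>, and what precedes it reaches
  \<open>H #> val q\<close>.\<close>

lemma dst_outside:
  assumes H: "subgroup H G" and rw: "rw (q @ b # z)" and n: "\<not> pre H (q @ [b])"
  shows "dst H (H #> val (q @ b # z)) = dst H (H #> val q) + Suc (length z)"
proof (rule antisym)
  have S: "set q \<subseteq> S" "b \<in> S" "set z \<subseteq> S"
    using rw rw_set by (auto simp: rw_def)
  obtain w where w: "rw w" "H #> val w = H #> val q" "length w = dst H (H #> val q)"
    using least_word[OF H, of "val q"] S by auto
  have "set w \<subseteq> S" using w rw_set by blast
  have "val (w @ b # z) \<otimes> inv (val (q @ b # z)) = val w \<otimes> inv (val q)"
    using S \<open>set w \<subseteq> S\<close> by (simp add: inv_mult_group m_assoc)
  moreover have "val w \<otimes> inv (val q) \<in> H"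
    using w(2) rcos_eq_iff[OF H] S \<open>set w \<subseteq> S\<close> by simp
  ultimately have "H #> val (w @ b # z) = H #> val (q @ b # z)"
    using rcos_eq_iff[OF H] S \<open>set w \<subseteq> S\<close> by simp
  then show "dst H (H #> val (q @ b # z)) \<le> dst H (H #> val q) + Suc (length z)"
    using dst_le[of "w @ b # z" H] S w(3) \<open>set w \<subseteq> S\<close> by simp
  obtain y where y: "rw y" "H #> val y = H #> val (q @ b # z)"
    "length y = dst H (H #> val (q @ b # z))"
    using least_word[OF H, of "val (q @ b # z)"] rw rw_set val_closed by blast
  obtain q' where q': "y = q' @ b # z" "H #> val q' = H #> val q"
    using coset_rep_outside[OF H rw y(1) n y(2)] by blast
  have "set q' \<subseteq> S" using q' y rw_set[of y] by simp
  then have "dst H (H #> val q) \<le> length q'"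
    using dst_le[of q' H] q' by simp
  then show "dst H (H #> val q) + Suc (length z) \<le> dst H (H #> val (q @ b # z))"
    using q' y(3) by simp
qed

text \<open>The factor \<open>winv q'\<close> can cancel into \<open>x\<close>, but the letter
  \<open>b\<close> is only reached if \<open>x\<close> begins with \<open>q' @ [inv b]\<close>.
  Otherwise \<open>q @ [b]\<close> survives in the product.\<close>

lemma nf_ping:
  assumes rw: "rw (q @ b # winv q')" and x: "x \<in> carrier G"
    and n: "\<nexists>z. nf x = q' @ inv b # z" and q': "set q' \<subseteq> S"
  shows "\<exists>z. nf (val (q @ b # winv q') \<otimes> x) = q @ b # z"
proof -
  have S: "set q \<subseteq> S" "b \<in> S" "inv b \<in> S"
    using rw rw_set S_inv by (auto simp: rw_def)
  define y where "y = nf (inv (val q') \<otimes> x)"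
  have y: "rw y" "val y = inv (val q') \<otimes> x" "set y \<subseteq> S"
    using nf_props set_nf x q' by (auto simp: y_def)
  have "rw (b # winv q')"
    using rw rw_appendD by blast
  then have "rw (winv (b # winv q'))"
    by (rule rw_winv)
  then have rq: "rw (q' @ [inv b])"
    using q' by (simp add: winv_Cons)
  \<comment> \<open>If \<open>y\<close> started with \<open>inv b\<close>, then
    \<open>q' @ y\<close> would be reduced and hence the normal form of \<open>x\<close>, which is
    excluded by \<open>n\<close>.\<close>
  have "y = [] \<or> hd y \<noteq> inv b"
  proof (rule ccontr)
    assume "\<not> (y = [] \<or> hd y \<noteq> inv b)"
    then obtain z where z: "y = inv b # z"
      by (cases y) auto
    then have "rw (q' @ inv b # z)"
      using rq y rw_overlap1 by blast
    moreover have "val (q' @ inv b # z) = x"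
    proof -
      have "val (q' @ y) = x" using y q' x by simp
      then show ?thesis by (simp add: z)
    qed
    ultimately have "nf x = q' @ inv b # z"
      by (rule nf_eqI)
    then show False using n by blast
  qed
  then have "rw (b # y)"
    using S y by (auto simp: rw_Cons)
  moreover have "rw (q @ [b])"
    using rw by (auto simp: rw_append rw_Cons)
  ultimately have "rw (q @ b # y)"
    by (simp add: rw_overlap1)
  moreover have "val (q @ b # y) = val (q @ b # winv q') \<otimes> x"
    using S y q' x by (simp add: m_assoc)
  ultimately have "nf (val (q @ b # winv q') \<otimes> x) = q @ b # y"
    by (rule nf_eqI)
  then show ?thesis by blast
qed

section \<open>Alternating words in two subgroups\<close>

lemma alternating_Cons:
  "(t, x) # w \<in> alternating_words G H K \<longleftrightarrow>
    x \<in> (if t then H else K) \<and> x \<noteq> \<one> \<and> w \<in> alternating_words G H K \<and>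
    (w = [] \<or> fst (hd w) \<noteq> t)"
  by (cases w) (auto simp: alternating_words_def)

lemma alternating_closed:
  assumes "subgroup H G" "subgroup K G" "w \<in> alternating_words G H K"
  shows "val (map snd w) \<in> carrier G"
  using assms(3)
proof (induction w)
  case (Cons e w)
  then show ?case
    using assms(1,2)[THEN subgroup.subset]
    by (cases e) (auto simp: alternating_Cons split: if_splits)
qed simp

text \<open>The values of alternating words contain the identity and are stable under left
  multiplication by \<open>H\<close> and \<open>K\<close>, hence by everything they
  generate.\<close>

lemma generate_alternating:
  assumes H: "subgroup H G" and K: "subgroup K G" and x: "x \<in> generate G (H \<union> K)"
  shows "\<exists>w \<in> alternating_words G H K. val (map snd w) = x"
proof -
  \<comment> \<open>A new factor becomes a new syllable, or merges with the first one if both lie in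
    the same subgroup; a trivial syllable is dropped.\<close>
  have mult: "\<exists>w' \<in> alternating_words G H K. val (map snd w') = h \<otimes> val (map snd w)"
    if h: "h \<in> (if t then H else K)" and w: "w \<in> alternating_words G H K" for t h w
  proof -
    have sub: "subgroup (if t then H else K) G"
      using H K by simp
    have hc: "h \<in> carrier G"
      using subgroup.mem_carrier[OF sub h] .
    show ?thesis
    proof (cases "h = \<one>")
      case True
      then show ?thesis
        using w alternating_closed[OF H K w] by (intro bexI[of _ w]) auto
    next
      case h1: False
      show ?thesis
      proof (cases "w = [] \<or> fst (hd w) \<noteq> t")
        case True
        then have "(t, h) # w \<in> alternating_words G H K"
          using h h1 w alternating_Cons by blast
        then show ?thesis
          by (intro bexI[of _ "(t, h) # w"]) auto
      next
        case False
        then obtain y v where wv: "w = (t, y) # v"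
          by (cases w) auto
        then have y: "y \<in> (if t then H else K)" "v \<in> alternating_words G H K"
          "v = [] \<or> fst (hd v) \<noteq> t"
          using w alternating_Cons[of t y v H K] by blast+
        have yc: "y \<in> carrier G" "val (map snd v) \<in> carrier G"
          using subgroup.mem_carrier[OF sub y(1)] alternating_closed[OF H K y(2)] by auto
        have eq: "h \<otimes> val (map snd w) = (h \<otimes> y) \<otimes> val (map snd v)"
          using hc yc by (simp add: wv m_assoc)
        show ?thesis
        proof (cases "h \<otimes> y = \<one>")
          case True
          then show ?thesis
            using eq yc y(2) by (intro bexI[of _ v]) auto
        next
          case False
          moreover have "h \<otimes> y \<in> (if t then H else K)"
            by (rule subgroup.m_closed[OF sub h y(1)])
          ultimately have "(t, h \<otimes> y) # v \<in> alternating_words G H K"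
            using y alternating_Cons by blast
          then show ?thesis
            using eq by (intro bexI[of _ "(t, h \<otimes> y) # v"]) auto
        qed
      qed
    qed
  qed
  \<comment> \<open>Quantifying over \<open>w\<close> lets the two factors of a product act one
    after the other in the case \<open>eng\<close>.\<close>
  have "\<forall>w \<in> alternating_words G H K. \<exists>w' \<in> alternating_words G H K.
      val (map snd w') = x \<otimes> val (map snd w)"
    using x
  proof (induction rule: generate.induct)
    case one
    then show ?case
      using alternating_closed[OF H K] by auto
  next
    case (incl h)
    then have "h \<in> (if True then H else K) \<or> h \<in> (if False then H else K)"
      by simp
    then show ?case using mult by blast
  next
    case (inv h)
    then have "inv h \<in> (if True then H else K) \<or> inv h \<in> (if False then H else K)"
      using subgroup.m_inv_closed[OF H] subgroup.m_inv_closed[OF K] by auto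
    then show ?case using mult by blast
  next
    case (eng h1 h2)
    have sub: "H \<union> K \<subseteq> carrier G"
      using H K subgroup.subset by blast
    have c: "h1 \<in> carrier G" "h2 \<in> carrier G"
      using eng(1,2) generate_in_carrier[OF sub] by auto
    show ?case
    proof
      fix w assume w: "w \<in> alternating_words G H K"
      obtain w2 where w2: "w2 \<in> alternating_words G H K" "val (map snd w2) = h2 \<otimes> val (map snd w)"
        using eng.IH(2) w by blast
      obtain w1 where "w1 \<in> alternating_words G H K" "val (map snd w1) = h1 \<otimes> val (map snd w2)"
        using eng.IH(1) w2 by blast
      then show "\<exists>w' \<in> alternating_words G H K. val (map snd w') = h1 \<otimes> h2 \<otimes> val (map snd w)"
        using w2 c alternating_closed[OF H K w] by (auto simp: m_assoc)
    qed
  qed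
  moreover have "[] \<in> alternating_words G H K"
    by (simp add: alternating_words_def)
  moreover have "x \<in> carrier G"
    using x generate_in_carrier[of "H \<union> K" x] H K subgroup.subset by blast
  ultimately show ?thesis by force
qed

end

text \<open>The element \<open>val (p @ a # winv p')\<close> leaves the core of \<open>H\<close> at the end of \<open>p\<close>, and its
  inverse leaves the core at the end of \<open>p'\<close>. Since both ends lie at about the same distance
  from \<open>o\<close>, neither of the two exit arcs lies on the other path.\<close>

locale balanced_exit = symmetric_free_generators +
  fixes H :: "'a set" and p :: "'a list" and a :: 'a and p' :: "'a list"
  assumes H: "subgroup H G"
    and rw_path: "rw (p @ a # winv p')"
    and set_p': "set p' \<subseteq> S"
    and exit: "\<not> pre H (p @ [a])" and exit': "\<not> pre H (p' @ [inv a])"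
    and balanced: "dst H (H #> val p) \<le> Suc (dst H (H #> val p'))"
      "dst H (H #> val p') \<le> Suc (dst H (H #> val p))"
begin

definition exits :: "('a list \<times> 'a) set" where
  "exits = {(p, a), (p', inv a)}"

text \<open>The ping-pong set: elements whose reduced word runs along one of the two paths and then
  across its exit arc.\<close>

definition beyond :: "'a set" where
  "beyond = {x \<in> carrier G. \<exists>(q, b) \<in> exits. \<exists>z. nf x = q @ b # z}"

text \<open>Words tracing the core of \<open>H\<close> with the paths \<open>p\<close> and
  \<open>p'\<close> attached, the two exit arcs themselves being left out.\<close>

definition inside :: "'a list \<Rightarrow> bool" where
  "inside q \<longleftrightarrow> pre H q \<or> (\<exists>z. p = q @ z) \<or> (\<exists>z. p' = q @ z)"

lemma exits_mem: "(p, a) \<in> exits" "(p', inv a) \<in> exits"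
  by (simp_all add: exits_def)

lemma a_in: "a \<in> S" "inv a \<in> S" "inv a \<noteq> a"
  using rw_set[OF rw_path] S_inv S_inv_neq by auto

lemma rw_path': "rw (p' @ inv a # winv p)"
proof -
  have "winv (p @ a # winv p') = p' @ inv a # winv p"
    using set_p' by (simp add: winv_Cons)
  then show ?thesis
    using rw_winv[OF rw_path] by simp
qed

lemma exits_props:
  assumes "(q, b) \<in> exits"
  shows "rw (q @ [b])" "\<not> pre H (q @ [b])" "set q \<subseteq> S" "b \<in> S"
proof -
  have "rw (p @ [a])" "rw (p' @ [inv a])"
    using rw_path rw_path' by (auto simp: rw_append rw_Cons)
  then show "rw (q @ [b])" "\<not> pre H (q @ [b])"
    using assms exit exit' by (auto simp: exits_def)
  then show "set q \<subseteq> S" "b \<in> S"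
    using rw_set[of "q @ [b]"] by auto
qed

text \<open>An exit arc lying on \<open>q'\<close> would make \<open>q'\<close> end strictly farther
  from \<open>o\<close> than \<open>q\<close>. So the two exits differ, and balance leaves a gap of
  one: the arc is the last one of \<open>q'\<close> and \<open>b' = inv b\<close>. Then
  \<open>q' @ [b']\<close> would backtrack, although it is reduced.\<close>

lemma exit_not_on_path:
  assumes e: "(q, b) \<in> exits" "(q', b') \<in> exits"
    and q': "q' = q1 @ b # z" and co: "H #> val q1 = H #> val q"
  shows False
proof -
  have rwq': "rw (q' @ [b'])" using exits_props e by blast
  then have rw1: "rw (q1 @ b # z)"
    using q' rw_appendD by blast
  then have "rw (q1 @ [b])"
    by (auto simp: rw_append rw_Cons)
  then have n: "\<not> pre H (q1 @ [b])"
    using pre_cong_coset[OF H exits_props(1)[OF e(1)], of q1] co exits_props(2)[OF e(1)] by auto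
  have d: "dst H (H #> val q') = dst H (H #> val q) + Suc (length z)"
    using dst_outside[OF H rw1 n] q' co by simp
  then have ne: "(q, b) \<noteq> (q', b')" by auto
  then have b': "b' = inv b"
    using e a_in by (auto simp: exits_def)
  have "dst H (H #> val q') \<le> Suc (dst H (H #> val q))"
    using e balanced by (auto simp: exits_def)
  then have "z = []" using d by simp
  then show False
    using rwq' q' b' by (simp add: rw_append rw_Cons)
qed

text \<open>The exit arcs lie outside the core of \<open>H\<close>, and by
  \<open>exit_not_on_path\<close> neither of them lies on \<open>p\<close> or
  \<open>p'\<close>.\<close>

lemma inside_not_exit:
  assumes q: "inside q" and e: "(q', b') \<in> exits"
    and eq: "q = q1 @ b' # z" and co: "H #> val q1 = H #> val q'"
  shows False
  using q unfolding inside_def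
proof (elim disjE exE)
  assume "pre H q"
  then have "pre H (q1 @ [b'])"
    using eq pre_appendD[of H "q1 @ [b']" z] by simp
  then show False
    using pre_cong_coset[OF H exits_props(1)[OF e] _ co[symmetric]] pre_rw exits_props(2)[OF e] by blast
next
  fix y assume "p = q @ y"
  then have "p = q1 @ b' # (z @ y)" using eq by simp
  then show False
    using exit_not_on_path[OF e exits_mem(1)] co by blast
next
  fix y assume "p' = q @ y"
  then have "p' = q1 @ b' # (z @ y)" using eq by simp
  then show False
    using exit_not_on_path[OF e exits_mem(2)] co by blast
qed

text \<open>Left translation by \<open>H\<close> does not move the vertices that a path visits after
  leaving the core. So membership of an \<open>H\<close>-translate in \<open>beyond\<close> can be
  read off \<open>q\<close> itself, as the use of an exit arc.\<close>

lemma beyond_coset: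
  assumes "h \<in> H" "rw q" "h \<otimes> val q \<in> beyond"
  obtains q1 b z q' where "(q', b) \<in> exits" "q = q1 @ b # z" "H #> val q1 = H #> val q'"
proof -
  obtain q' b z where e: "(q', b) \<in> exits" "nf (h \<otimes> val q) = q' @ b # z"
    using assms(3) by (auto simp: beyond_def)
  have S: "set q \<subseteq> S" using assms rw_set by blast
  have hc: "h \<in> carrier G" using subgroup.mem_carrier[OF H assms(1)] .
  have n: "rw (q' @ b # z)" "val (q' @ b # z) = h \<otimes> val q"
    using nf_props[of "h \<otimes> val q"] e(2) S hc by auto
  have "H #> val q = H #> val (q' @ b # z)"
    unfolding n(2) using rcos_eq_iff[OF H, of "h \<otimes> val q" "val q"] S hc assms(1)
    by (simp add: m_assoc)
  then show ?thesis
    using coset_rep_outside[OF H n(1) assms(2) exits_props(2)[OF e(1)]] that e(1) by metis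
qed

lemma inside_not_beyond:
  assumes "inside q" "rw q" "h \<in> H"
  shows "h \<otimes> val q \<notin> beyond"
  using beyond_coset[OF assms(3,2)] inside_not_exit[OF assms(1)] by metis

lemma inside_Nil: "inside []"
  using pre_Nil[OF H] by (simp add: inside_def)

text \<open>First half of ping-pong. Translation by \<open>h\<close> rewrites only the part before
  the exit arc. If the result runs across an exit again, then either both exits occupy the same
  place, which forces \<open>h = \<one>\<close>, or one exit arc lies on the path to the
  other.\<close>

lemma translate_beyond:
  assumes y: "y \<in> beyond" and h: "h \<in> H" "h \<noteq> \<one>"
  shows "h \<otimes> y \<notin> beyond"
proof
  assume hy: "h \<otimes> y \<in> beyond"
  have hc: "h \<in> carrier G" using subgroup.mem_carrier[OF H h(1)] .
  obtain q b z where e: "(q, b) \<in> exits" "nf y = q @ b # z" and yc: "y \<in> carrier G"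
    using y by (auto simp: beyond_def)
  have n: "rw (q @ b # z)" "val (q @ b # z) = y"
    using nf_props[OF yc] e(2) by auto
  obtain q' b' z' where e': "(q', b') \<in> exits" "nf (h \<otimes> y) = q' @ b' # z'"
    using hy by (auto simp: beyond_def)
  define u where "u = nf (h \<otimes> val q)"
  have S: "set q \<subseteq> S" "set q' \<subseteq> S" using exits_props e e' by auto
  have u: "rw u" "val u = h \<otimes> val q"
    using nf_props S hc by (auto simp: u_def)
  have uq: "H #> val u = H #> val q"
    unfolding u(2) using rcos_eq_iff[OF H, of "h \<otimes> val q" "val q"] S hc h(1)
    by (simp add: m_assoc)
  have eq: "u @ b # z = q' @ b' # z'"
    using nf_translate(1)[OF H h(1) n(1) exits_props(2)[OF e(1)]] n(2) e'(2) u_def by simp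
  consider "u = q'" "b = b'" | us where "u = q' @ b' # us" | us where "q' = u @ b # us"
    using eq by (auto simp: append_eq_append_conv2 Cons_eq_append_conv append_eq_Cons_conv)
  then show False
  proof cases
    case 1
    then have "q = q'"
      using e(1) e'(1) a_in by (auto simp: exits_def)
    then have "h \<otimes> val q = \<one> \<otimes> val q"
      using 1 u S by simp
    then show False
      using h hc S right_cancel[of "val q" h \<one>] by simp
  next
    case (2 us)
    have rwq: "rw q" using exits_props(1)[OF e(1)] rw_appendD by blast
    have "rw (q' @ b' # us)" using u(1) 2 by simp
    moreover have "H #> val q = H #> val (q' @ b' # us)"
      using uq 2 by simp
    ultimately obtain q1 where "q = q1 @ b' # us" "H #> val q1 = H #> val q'"
      using coset_rep_outside[OF H _ rwq exits_props(2)[OF e'(1)]] by blast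
    then show False
      using exit_not_on_path[OF e'(1) e(1)] by blast
  next
    case (3 us)
    then show False
      using exit_not_on_path[OF e(1) e'(1)] uq by blast
  qed
qed

abbreviation t :: 'a where
  "t \<equiv> val (p @ a # winv p')"

lemma set_p: "set p \<subseteq> S"
  using rw_set[OF rw_path] by simp

lemma t_closed: "t \<in> carrier G"
  by (rule val_closed) (rule rw_set[OF rw_path])

lemma inv_t: "inv t = val (p' @ inv a # winv p)"
proof -
  have "val (winv (p @ a # winv p')) = inv t"
    by (rule val_winv) (rule rw_set[OF rw_path])
  then show ?thesis
    using set_p' by (simp add: winv_Cons)
qed

lemma exits_disjoint:
  assumes "nf x = p @ a # z" "nf x = p' @ inv a # z'"
  shows False
proof -
  have "p @ a # z = p' @ inv a # z'"
    using assms by simp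
  then consider "a = inv a" | us where "p = p' @ inv a # us" | us where "p' = p @ a # us"
    by (auto simp: append_eq_append_conv2 Cons_eq_append_conv append_eq_Cons_conv)
  then show False
  proof cases
    case (2 us)
    then show False
      using exit_not_on_path[OF exits_mem(2,1)] by blast
  next
    case (3 us)
    then show False
      using exit_not_on_path[OF exits_mem] by blast
  qed (use a_in in simp)
qed

text \<open>By \<open>nf_ping\<close> one factor \<open>t\<close> produces a word starting with
  \<open>p @ [a]\<close>. Such a word does not start with \<open>p' @ [inv a]\<close>, so the step
  can be repeated.\<close>

lemma t_pow_forward:
  assumes x: "x \<in> carrier G" and n: "\<nexists>z. nf x = p' @ inv a # z"
  shows "\<exists>z. nf (t [^] Suc k \<otimes> x) = p @ a # z"
proof (induction k)
  case 0
  then show ?case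
    using nf_ping[OF rw_path x n set_p'] t_closed by (simp add: nat_pow_Suc)
next
  case (Suc k)
  have c: "t [^] Suc k \<otimes> x \<in> carrier G"
    using t_closed x by blast
  have "t [^] Suc (Suc k) \<otimes> x = t \<otimes> (t [^] Suc k \<otimes> x)"
    using t_closed x by (metis m_assoc nat_pow_closed nat_pow_Suc2)
  moreover have "\<nexists>z. nf (t [^] Suc k \<otimes> x) = p' @ inv a # z"
    using Suc.IH exits_disjoint by blast
  ultimately show ?case
    using nf_ping[OF rw_path c _ set_p'] by presburger
qed

text \<open>The setting is symmetric: exchanging the two exits replaces \<open>t\<close> by its
  inverse, so statements on positive powers transfer to negative ones.\<close>

lemma inverse_exit: "balanced_exit G S H p' (inv a) p"
  by (intro balanced_exit.intro balanced_exit_axioms.intro symmetric_free_generators_axioms)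
    (use H rw_path' set_p exit exit' balanced a_in in simp_all)

text \<open>Second half of ping-pong; negative exponents are handled with the two exits
  exchanged.\<close>

lemma t_int_pow_beyond:
  assumes x: "x \<in> carrier G" "x \<notin> beyond" and k: "(k :: int) \<noteq> 0"
  shows "t [^] k \<otimes> x \<in> beyond"
proof (cases "k > 0")
  case True
  then obtain m where m: "k = int (Suc m)"
    by (metis gr0_implies_Suc zero_less_imp_eq_int of_nat_0_less_iff)
  have "\<exists>z. nf (t [^] Suc m \<otimes> x) = p @ a # z"
    by (rule t_pow_forward[OF x(1)]) (use x in \<open>auto simp: beyond_def exits_def\<close>)
  moreover have "t [^] k = t [^] Suc m"
    unfolding m by (rule int_pow_int)
  ultimately show ?thesis
    using t_closed x by (auto simp: beyond_def exits_def)
next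
  case False
  then obtain m where m: "k = - int (Suc m)"
    using k by (metis int_cases2 nat.exhaust of_nat_0_less_iff neg_0_equal_iff_equal of_nat_0 zero_less_Suc)
  interpret inverse: balanced_exit G S H p' "inv a" p
    by (rule inverse_exit)
  have "\<exists>z. nf (inverse.t [^] Suc m \<otimes> x) = p' @ inv a # z"
    by (rule inverse.t_pow_forward[OF x(1)]) (use x a_in in \<open>auto simp: beyond_def exits_def\<close>)
  moreover have "t [^] k = inverse.t [^] Suc m"
    unfolding m inv_t[symmetric] using t_closed by (metis int_pow_neg_int nat_pow_inv)
  moreover have "inverse.t [^] Suc m \<otimes> x \<in> carrier G"
    using inverse.t_closed x by blast
  ultimately show ?thesis
    using x by (auto simp: beyond_def exits_def)
qed

section \<open>Ping-pong and the free product\<close>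

abbreviation K :: "'a set" where
  "K \<equiv> generate G {t}"

lemma K: "subgroup K G"
  using t_closed generate_is_subgroup by simp

lemma H_carrier: "h \<in> H \<Longrightarrow> h \<in> carrier G"
  using subgroup.mem_carrier[OF H] .

text \<open>Reading syllables from the right, those from \<open>K\<close> push into
  \<open>beyond\<close> and those from \<open>H\<close> push out. The whole \<open>H\<close>-orbit
  of \<open>y\<close> has to avoid \<open>beyond\<close> because the last syllable may come from
  \<open>H\<close>.\<close>

lemma alternating_ping_pong:
  assumes w: "w \<in> alternating_words G H K" "w \<noteq> []"
    and y: "y \<in> carrier G" "\<And>h. h \<in> H \<Longrightarrow> h \<otimes> y \<notin> beyond"
  shows "val (map snd w) \<otimes> y \<in> beyond \<longleftrightarrow> \<not> fst (hd w)"
  using w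
proof (induction w)
  case (Cons e w)
  obtain s x where e: "e = (s, x)" by (cases e)
  have w: "x \<in> (if s then H else K)" "x \<noteq> \<one>" "w \<in> alternating_words G H K"
    "w = [] \<or> fst (hd w) \<noteq> s"
    using Cons.prems(1) unfolding e alternating_Cons by auto
  have wc: "val (map snd w) \<in> carrier G"
    by (rule alternating_closed[OF H K w(3)])
  have xc: "x \<in> carrier G"
    using w(1) subgroup.mem_carrier[OF K] H_carrier by (auto split: if_splits)
  let ?v = "val (map snd w) \<otimes> y"
  have eq: "val (map snd (e # w)) \<otimes> y = x \<otimes> ?v"
    using e xc wc y by (simp add: m_assoc)
  have "?v \<in> beyond \<longleftrightarrow> s" if "w \<noteq> []"
    using Cons.IH[OF w(3) that] w(4) that by auto
  moreover have "?v = y" if "w = []"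
    using that y by simp
  moreover have "y \<notin> beyond"
    using y(2)[OF subgroup.one_closed[OF H]] y(1) by simp
  ultimately have v: "w = [] \<and> ?v = y \<and> y \<notin> beyond \<or> (?v \<in> beyond \<longleftrightarrow> s)"
    by blast
  show ?case
  proof (cases s)
    case True
    then have "x \<in> H" using w by simp
    then have "x \<otimes> ?v \<notin> beyond"
      using v True y translate_beyond w(2) by metis
    then show ?thesis using eq e True by simp
  next
    case False
    then have "x \<in> K" using w by simp
    then obtain k :: int where k: "x = t [^] k"
      using generate_pow[OF t_closed] by blast
    then have "k \<noteq> 0" using w(2) by auto
    then have "x \<otimes> ?v \<in> beyond"
      using t_int_pow_beyond[of ?v k] v False k wc y by auto
    then show ?thesis using eq e False by simp
  qed
qed simp

lemma alternating_at_one: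
  assumes w: "w \<in> alternating_words G H K" "w \<noteq> []"
  shows "val (map snd w) \<in> beyond \<longleftrightarrow> \<not> fst (hd w)"
proof -
  have "h \<otimes> \<one> \<notin> beyond" if "h \<in> H" for h
    using inside_not_beyond[OF inside_Nil rw_Nil that] by simp
  then show ?thesis
    using alternating_ping_pong[OF w one_closed] alternating_closed[OF H K w(1)] by simp
qed

lemma one_not_beyond: "\<one> \<notin> beyond"
  using inside_not_beyond[OF inside_Nil rw_Nil subgroup.one_closed[OF H]] by simp

text \<open>The identity is not in \<open>beyond\<close>, so a trivial word would start with some
  \<open>x\<close> in \<open>H\<close>. The remaining syllables would then have value
  \<open>inv x\<close>, yet they are either absent or have their value in \<open>beyond\<close>,
  which is disjoint from \<open>H\<close>.\<close>

lemma alternating_nontrivial: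
  assumes w: "w \<in> alternating_words G H K" "w \<noteq> []"
  shows "val (map snd w) \<noteq> \<one>"
proof
  assume 1: "val (map snd w) = \<one>"
  obtain s x v where wv: "w = (s, x) # v"
    using w(2) by (cases w) auto
  then have v: "x \<in> (if s then H else K)" "x \<noteq> \<one>" "v \<in> alternating_words G H K"
    "v = [] \<or> fst (hd v) \<noteq> s"
    using w(1) alternating_Cons[of s x v H K] by blast+
  have s: s
    using alternating_at_one[OF w] 1 one_not_beyond wv by simp
  then have x: "x \<in> H" "inv x \<in> H"
    using v subgroup.m_inv_closed[OF H] by auto
  have "v \<noteq> []"
    using 1 wv v H_carrier[OF x(1)] by auto
  then have "val (map snd v) \<in> beyond"
    using alternating_at_one[OF v(3)] v(4) s by simp
  moreover have "val (map snd v) = inv x"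
    using 1 wv H_carrier[OF x(1)] alternating_closed[OF H K v(3)]
    by (simp add: inv_equality[symmetric] inv_comm)
  ultimately show False
    using inside_not_beyond[OF inside_Nil rw_Nil x(2)] H_carrier[OF x(2)] by simp
qed

text \<open>Whether the value lies in \<open>beyond\<close> reveals the factor of the first
  syllable, so two words with equal value start in the same factor and can be compared syllable by
  syllable.\<close>

lemma internal_free_product: "internal_free_product G H K (generate G (H \<union> K))"
proof -
  have "w = w'" if "w \<in> alternating_words G H K" "w' \<in> alternating_words G H K"
    "val (map snd w) = val (map snd w')" for w w'
    using that
  proof (induction "length w + length w'" arbitrary: w w' rule: less_induct)
    case less
    show ?case
    proof (cases "w = [] \<or> w' = []")
      case True
      then show ?thesis
        using less.prems alternating_nontrivial by (metis list.map_disc_iff val_Nil)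
    next
      case False
      then obtain s x v s' x' v' where wv: "w = (s, x) # v" "w' = (s', x') # v'"
        by (metis list.exhaust prod.exhaust)
      have v: "x \<in> (if s then H else K)" "x \<noteq> \<one>" "v \<in> alternating_words G H K"
          "v = [] \<or> fst (hd v) \<noteq> s"
        and v': "x' \<in> (if s' then H else K)" "x' \<noteq> \<one>" "v' \<in> alternating_words G H K"
          "v' = [] \<or> fst (hd v') \<noteq> s'"
        using less.prems(1,2) wv alternating_Cons[of _ _ _ H K] by blast+
      have s: "s' = s"
        using alternating_at_one[OF less.prems(1)] alternating_at_one[OF less.prems(2)]
          less.prems(3) False wv by simp
      have sub: "subgroup (if s then H else K) G"
        using H K by simp
      have c: "x \<in> carrier G" "x' \<in> carrier G" "val (map snd v) \<in> carrier G"
        "val (map snd v') \<in> carrier G"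
        using v v' s subgroup.mem_carrier[OF sub] alternating_closed[OF H K] by auto
      have eq: "x \<otimes> val (map snd v) = x' \<otimes> val (map snd v')"
        using less.prems(3) wv by simp
      show ?thesis
      proof (cases "x = x'")
        case True
        then have "val (map snd v) = val (map snd v')"
          using eq c by simp
        then have "v = v'"
          using less.hyps[of v v'] v(3) v'(3) wv by simp
        then show ?thesis using True s wv by simp
      next
        \<comment> \<open>Distinct first syllables are merged into one syllable in front of
          \<open>v'\<close>. The total length drops by one, and the induction hypothesis makes
          \<open>v\<close> start in factor \<open>s\<close>, which alternation of \<open>w\<close>
          forbids.\<close>
        case False
        have "inv x \<otimes> x' \<in> (if s then H else K)"
          using v(1) v'(1) s subgroup.m_closed[OF sub] subgroup.m_inv_closed[OF sub] by auto
        moreover have "inv x \<otimes> x' \<noteq> \<one>"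
          using False c by (metis inv_equality inv_closed inv_inv inv_comm)
        ultimately have alt: "(s, inv x \<otimes> x') # v' \<in> alternating_words G H K"
          using v'(3,4) s alternating_Cons by blast
        have "val (map snd v) = inv x \<otimes> (x \<otimes> val (map snd v))"
          using c by simp
        also have "\<dots> = val (map snd ((s, inv x \<otimes> x') # v'))"
          using c eq by (simp add: m_assoc)
        finally have "v = (s, inv x \<otimes> x') # v'"
          using less.hyps[of v "(s, inv x \<otimes> x') # v'"] v(3) alt wv by simp
        then show ?thesis using v(4) by simp
      qed
    qed
  qed
  then show ?thesis
    using H K by (auto simp: internal_free_product_def inj_on_def)
qed

section \<open>The core of the enlarged subgroup near the base vertex\<close>

abbreviation H1 :: "'a set" where
  "H1 \<equiv> generate G (H \<union> K)"

lemma H1: "subgroup H1 G" and H_le_H1: "H \<subseteq> H1" and t_in_H1: "t \<in> H1"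
proof -
  have "H \<union> K \<subseteq> carrier G"
    using H K subgroup.subset by blast
  then show "subgroup H1 G"
    by (rule generate_is_subgroup)
  show "H \<subseteq> H1" "t \<in> H1"
    by (auto intro: generate.incl)
qed

text \<open>Once a first syllable from \<open>H\<close> has been undone, an alternating word that is
  not exhausted starts in \<open>K\<close>, and such a word sends \<open>y\<close> into
  \<open>beyond\<close>.\<close>

lemma H1_cases:
  assumes x: "x \<in> H1" and y: "y \<in> carrier G" "\<And>h. h \<in> H \<Longrightarrow> h \<otimes> y \<notin> beyond"
  shows "x \<in> H \<or> (\<exists>h \<in> H. h \<otimes> (x \<otimes> y) \<in> beyond)"
proof -
  obtain w where w: "w \<in> alternating_words G H K" "val (map snd w) = x"
    using generate_alternating[OF H K x] by blast
  have xc: "x \<in> carrier G" using subgroup.mem_carrier[OF H1 x] .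
  show ?thesis
  proof (cases "w = []")
    case True
    then show ?thesis using w subgroup.one_closed[OF H] by auto
  next
    case False
    then obtain s u v where wv: "w = (s, u) # v"
      by (cases w) auto
    then have v: "u \<in> (if s then H else K)" "v \<in> alternating_words G H K"
      "v = [] \<or> fst (hd v) \<noteq> s"
      using w(1) alternating_Cons[of s u v H K] by blast+
    show ?thesis
    proof (cases s)
      case s: True
      then have u: "u \<in> H" "inv u \<in> H" "u \<in> carrier G"
        using v subgroup.m_inv_closed[OF H] H_carrier by auto
      show ?thesis
      proof (cases "v = []")
        case True
        then show ?thesis using w wv u by auto
      next
        case False
        have "inv u \<otimes> (x \<otimes> y) = val (map snd v) \<otimes> y"
          using w(2) wv u y alternating_closed[OF H K v(2)] by (auto simp: m_assoc)
        moreover have "val (map snd v) \<otimes> y \<in> beyond"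
          using alternating_ping_pong[OF v(2) False y] v(3) False s by simp
        ultimately have "inv u \<otimes> (x \<otimes> y) \<in> beyond" by simp
        then show ?thesis using u(2) by blast
      qed
    next
      case s: False
      have "x \<otimes> y \<in> beyond"
        using alternating_ping_pong[OF w(1) False y] wv s w(2) by simp
      then show ?thesis
        using subgroup.one_closed[OF H] xc y by (intro disjI2 bexI[of _ \<one>]) auto
    qed
  qed
qed

text \<open>The element of \<open>H1\<close> carrying \<open>val q'\<close> to \<open>val q\<close>
  must lie in \<open>H\<close>: otherwise some \<open>H\<close>-translate of \<open>val q\<close>
  would be in \<open>beyond\<close>. So passing from cosets of \<open>H\<close> to cosets of
  \<open>H1\<close> identifies no vertices reached by inside words.\<close>

lemma inside_coset_inj:
  assumes q: "inside q" "rw q" and q': "inside q'" "rw q'"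
    and eq: "H1 #> val q = H1 #> val q'"
  shows "H #> val q = H #> val q'"
proof -
  have S: "set q \<subseteq> S" "set q' \<subseteq> S" using q q' rw_set by auto
  define x where "x = val q \<otimes> inv (val q')"
  have x: "x \<in> H1"
    unfolding x_def using eq rcos_eq_iff[OF H1] S by simp
  have "x \<otimes> val q' = val q"
    unfolding x_def using S by (simp add: m_assoc)
  then have "x \<in> H"
    using H1_cases[OF x, of "val q'"] inside_not_beyond[OF q] inside_not_beyond[OF q'] S by auto
  then show ?thesis
    unfolding x_def using rcos_eq_iff[OF H] S by simp
qed

text \<open>If the arc is not in the core of \<open>H\<close>, then a reduced loop for
  \<open>H1\<close> through it must cross an exit. It cannot cross before \<open>b\<close>, as
  \<open>q\<close> is inside. If it crosses at \<open>b\<close>, the arc is an exit arc; if later,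
  the arc lies on the path to that exit.\<close>

lemma inside_core_arc:
  assumes q: "inside q" and rw: "rw (q @ [b])" and pre: "pre H1 (q @ [b])"
  shows "(\<exists>q2. inside (q2 @ [b]) \<and> H #> val q2 = H #> val q) \<or>
    (\<exists>q2. (q2, b) \<in> exits \<and> H #> val q2 = H #> val q)"
proof (cases "pre H (q @ [b])")
  case True
  then show ?thesis by (auto simp: inside_def)
next
  case n: False
  obtain z where z: "rw (q @ b # z)" "val (q @ b # z) \<in> H1"
    using pre by (auto simp: pre_def)
  then have "val (q @ b # z) \<notin> H"
    using n by (auto simp: pre_def)
  moreover have c: "val (q @ b # z) \<in> carrier G"
    using z(1) rw_set val_closed by blast
  moreover have "h \<otimes> \<one> \<notin> beyond" if "h \<in> H" for h
    using inside_not_beyond[OF inside_Nil rw_Nil that] by simp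
  ultimately obtain h where h: "h \<in> H" "h \<otimes> val (q @ b # z) \<in> beyond"
    using H1_cases[OF z(2) one_closed] by auto
  obtain q1 b' z' q' where e: "(q', b') \<in> exits" "q @ b # z = q1 @ b' # z'"
    "H #> val q1 = H #> val q'"
    by (rule beyond_coset[OF h(1) z(1) h(2)])
  consider "q = q1" "b = b'" | us where "q = q1 @ b' # us" | us where "q1 = q @ b # us"
    using e(2) by (auto simp: append_eq_append_conv2 Cons_eq_append_conv append_eq_Cons_conv)
  then show ?thesis
  proof cases
    case 1
    then show ?thesis using e by metis
  next
    case (2 us)
    then show ?thesis using inside_not_exit[OF q e(1)] e(3) by blast
  next
    case (3 us)
    \<comment> \<open>The path has already left the core of \<open>H\<close> at \<open>b\<close>, so
      the word \<open>q'\<close> leading to the exit ends in the same letters \<open>b # us\<close>;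
      thus the arc belongs to \<open>p\<close> or \<open>p'\<close>.\<close>
    have "rw (q @ b # us)"
      using z(1) e(2) 3 rw_appendD by metis
    moreover have "rw q'"
      using exits_props(1)[OF e(1)] rw_appendD by blast
    moreover have "H #> val q' = H #> val (q @ b # us)"
      using e(3) 3 by simp
    ultimately obtain q2 where q2: "q' = q2 @ b # us" "H #> val q2 = H #> val q"
      using coset_rep_outside[OF H _ _ n] by blast
    have "q' = p \<or> q' = p'"
      using e(1) by (auto simp: exits_def)
    then have "inside (q2 @ [b])"
      using q2 by (auto simp: inside_def)
    then show ?thesis using q2 by blast
  qed
qed

lemma inside_pre_H1:
  assumes "inside q"
  shows "pre H1 q"
proof -
  have 1: "pre H1 p"
    using rw_path t_in_H1 by (auto simp: pre_def)
  have "inv t \<in> H1"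
    by (rule subgroup.m_inv_closed[OF H1 t_in_H1])
  then have 2: "pre H1 p'"
    using rw_path' inv_t by (auto simp: pre_def)
  from assms show ?thesis
    unfolding inside_def using 1 2 pre_mono[OF H_le_H1] pre_appendD by metis
qed

end

section \<open>Rays that leave the core\<close>

context symmetric_free_generators
begin

abbreviation wpow :: "'a list \<Rightarrow> nat \<Rightarrow> 'a list" where
  "wpow c n \<equiv> concat (replicate n c)"

lemma set_wpow: "set c \<subseteq> S \<Longrightarrow> set (wpow c n) \<subseteq> S"
  by auto

lemma wpow_add: "wpow c (m + n) = wpow c m @ wpow c n"
  by (simp add: replicate_add)

lemma val_wpow: "set c \<subseteq> S \<Longrightarrow> val (wpow c n) = val c [^] n"
proof (induction n)
  case (Suc n)
  have "val (wpow c (Suc n)) = val c \<otimes> val (wpow c n)"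
    using Suc.prems set_wpow[OF Suc.prems, of n] by simp
  also have "\<dots> = val c [^] Suc n"
    using Suc nat_pow_Suc2[of "val c" n] val_closed by simp
  finally show ?case .
qed simp

lemma rw_wpow:
  assumes "rw (c @ c)"
  shows "rw (wpow c n)"
proof (cases n)
  case (Suc m)
  have "rw (wpow c (Suc m))"
  proof (induction m)
    case 0
    then show ?case using rw_appendD(1)[OF assms] by simp
  next
    case (Suc m)
    then show ?case
      using rw_overlap[of c c "wpow c m"] assms by (cases "c = []") auto
  qed
  then show ?thesis using Suc by simp
qed simp

lemma winv_wpow: "winv (wpow c n) = wpow (winv c) n"
proof (induction n)
  case (Suc n)
  have "wpow d n @ d = d @ wpow d n" for d :: "'a list"
    by (induction n) auto
  then show ?case using Suc by simp
qed simp

lemma rw_conj_wpow: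
  assumes c: "c \<noteq> []" "rw (c @ c)" and ucu: "rw (u @ c @ winv u)"
  shows "rw (u @ wpow c (Suc n) @ winv u)"
proof -
  have "rw (wpow c (Suc n) @ winv u)"
  proof (induction n)
    case 0
    then show ?case using rw_appendD(2)[OF ucu] by simp
  next
    case (Suc n)
    have "rw (c @ c @ (wpow c n @ winv u))"
      using rw_overlap[of c c "wpow c n @ winv u"] c Suc by simp
    then show ?case by simp
  qed
  moreover have "rw (u @ c)"
    using ucu rw_appendD(1)[of "u @ c" "winv u"] by simp
  ultimately show ?thesis
    using rw_overlap[of u c "wpow c n @ winv u"] c by simp
qed

lemma val_conj_wpow:
  assumes "set u \<subseteq> S" "set c \<subseteq> S"
  shows "val (u @ wpow c n @ winv u) = val (u @ c @ winv u) [^] n"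
proof (induction n)
  case (Suc n)
  have S: "set (wpow c n) \<subseteq> S" using set_wpow assms by blast
  have "val (u @ wpow c (Suc n) @ winv u) =
      val (u @ c @ winv u) \<otimes> val (u @ wpow c n @ winv u)"
    using assms S by (simp add: m_assoc)
  also have "\<dots> = val (u @ c @ winv u) [^] Suc n"
    unfolding Suc.IH using assms by (subst nat_pow_Suc2) auto
  finally show ?case .
qed (use assms in simp)

text \<open>First and last letters are stripped while they are inverse to each other. The core word
  never becomes empty, because a letter is not its own inverse and a reduced word contains no
  cancelling pair.\<close>

lemma cyclically_reduced_conjugate:
  assumes "rw w" "w \<noteq> []"
  obtains u c where "w = u @ c @ winv u" "c \<noteq> []" "rw (c @ c)"
proof -
  have "\<exists>u c. w = u @ c @ winv u \<and> c \<noteq> [] \<and> rw (c @ c)"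
    using assms
  proof (induction w rule: length_induct)
    case (1 w)
    show ?case
    proof (cases "rw (w @ w)")
      case True
      then show ?thesis
        using 1 by (intro exI[of _ "[]"] exI[of _ w]) simp
    next
      case False
      then have hl: "hd w = inv (last w)"
        using 1 by (auto simp: rw_append)
      obtain a v where w: "w = a # v"
        using 1 by (cases w) auto
      have "a \<in> S" using 1 w by (simp add: rw_Cons)
      have "v \<noteq> []"
        using hl w S_inv_neq[OF \<open>a \<in> S\<close>] by (cases "v = []") auto
      then obtain v' b where v: "v = v' @ [b]"
        by (metis rev_exhaust)
      have "b \<in> S" using 1 w v rw_set[of w] by simp
      then have b: "b = inv a"
        using hl w v by simp
      have "v' \<noteq> []"
        using 1(2) w v b by (auto simp: rw_Cons)
      moreover have "rw v'"
        using 1(2) w v by (auto simp: rw_Cons rw_append)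
      ultimately obtain u c where uc: "v' = u @ c @ winv u" "c \<noteq> []" "rw (c @ c)"
        using 1(1)[rule_format, of v'] w v by auto
      then have "w = (a # u) @ c @ winv (a # u)"
        using w v b by (simp add: winv_Cons)
      then show ?thesis using uc by blast
    qed
  qed
  then show ?thesis using that by blast
qed

text \<open>With \<open>c\<close> cyclically reduced, the powers of \<open>u @ c @ winv u\<close>
  are represented by reduced words that contain copies of the non-empty word
  \<open>c\<close>.\<close>

lemma torsion_free:
  assumes g: "g \<in> carrier G" "g \<noteq> \<one>"
  shows "g [^] Suc m \<noteq> \<one>"
proof -
  have nf: "rw (nf g)" "val (nf g) = g" "nf g \<noteq> []"
    using nf_props[OF g(1)] g by auto
  obtain u c where uc: "nf g = u @ c @ winv u" "c \<noteq> []" "rw (c @ c)"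
    using cyclically_reduced_conjugate nf by blast
  have S: "set u \<subseteq> S" "set c \<subseteq> S"
    using uc(1) rw_set[OF nf(1)] by auto
  have rw: "rw (u @ wpow c (Suc m) @ winv u)"
    using rw_conj_wpow uc nf by metis
  have "val (u @ wpow c (Suc m) @ winv u) = g [^] Suc m"
    using val_conj_wpow[OF S, of "Suc m"] nf(2) uc(1) by simp
  then show ?thesis
    using rw_unique[OF rw rw_Nil] uc(2) by auto
qed

lemma pow_coset_eq:
  assumes H: "subgroup H G" and x: "x \<in> carrier G" "y \<in> carrier G"
    and eq: "H #> (y \<otimes> x [^] (i :: nat)) = H #> (y \<otimes> x [^] j)" and "i < j"
  shows "\<exists>m. (y \<otimes> x [^] Suc m \<otimes> inv y) \<in> H"
proof -
  obtain m where m: "j = Suc m + i"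
    using \<open>i < j\<close> less_iff_Suc_add by auto
  have "(y \<otimes> x [^] j) \<otimes> inv (y \<otimes> x [^] i) \<in> H"
    using eq rcos_eq_iff[OF H, of "y \<otimes> x [^] j" "y \<otimes> x [^] i"] x by simp
  moreover have "x [^] j = x [^] Suc m \<otimes> x [^] i"
    unfolding m using nat_pow_mult[OF x(1)] by metis
  ultimately have "y \<otimes> (x [^] Suc m \<otimes> x [^] i) \<otimes> (inv (x [^] i) \<otimes> inv y) \<in> H"
    using x by (simp add: inv_mult_group)
  moreover have "y \<otimes> (x [^] Suc m \<otimes> x [^] i) \<otimes> (inv (x [^] i) \<otimes> inv y) =
      y \<otimes> x [^] Suc m \<otimes> inv y"
    using x by (simp add: m_assoc del: nat_pow_Suc)
  ultimately show ?thesis by auto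
qed

text \<open>On a ray that stays in a finite core, two copies of \<open>c\<close> would begin with
  the same arc, and the segment between them would put a positive power of the conjugate of
  \<open>c\<close> into \<open>H\<close>.\<close>

lemma ray_leaves_core:
  assumes H: "subgroup H G" and fin: "finite (core_arcs H)"
    and c: "c \<noteq> []" and S: "set u \<subseteq> S" "set c \<subseteq> S"
    and n: "\<And>m. val (u @ c @ winv u) [^] Suc m \<notin> H"
  obtains k where "\<not> pre H (u @ wpow c k)"
proof -
  have "\<exists>k. \<not> pre H (u @ wpow c k)"
  proof (rule ccontr)
    assume "\<not> ?thesis"
    then have all: "pre H (u @ wpow c k)" for k by blast
    obtain a c' where ac: "c = a # c'"
      using c by (cases c) auto
    define f where "f k = (H #> val (u @ wpow c k), a)" for k
    have "f k \<in> core_arcs H" for k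
    proof -
      have "u @ wpow c (k + 1) = (u @ wpow c k @ [a]) @ c'"
        unfolding wpow_add by (simp add: ac)
      then have "pre H ((u @ wpow c k) @ [a])"
        using all[of "k + 1"] pre_appendD[of H "u @ wpow c k @ [a]" c'] by simp
      then show ?thesis
        unfolding f_def by (rule core_arcsI)
    qed
    then have "finite (range f)"
      using fin by (meson finite_subset image_subsetI)
    then have "\<not> inj f"
      using finite_imageD by blast
    then obtain i j where "f i = f j" "i \<noteq> j"
      by (auto simp: inj_def)
    then obtain i j where ij: "f i = f j" "i < j"
      by (metis linorder_neqE_nat)
    then have "H #> (val u \<otimes> val c [^] i) = H #> (val u \<otimes> val c [^] j)"
      using S set_wpow[OF S(2)] val_wpow[OF S(2)] by (simp add: f_def)
    then obtain m where "val u \<otimes> val c [^] Suc m \<otimes> inv (val u) \<in> H"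
      using pow_coset_eq[OF H, of "val c" "val u" i j] ij(2) S by auto
    moreover have "val u \<otimes> val c [^] Suc m \<otimes> inv (val u) = val (u @ wpow c (Suc m) @ winv u)"
      using S set_wpow[OF S(2), of "Suc m"] val_wpow[OF S(2), of "Suc m"]
      by (simp add: m_assoc del: replicate.simps nat_pow_Suc)
    ultimately show False
      using n val_conj_wpow[OF S] by metis
  qed
  then show ?thesis using that by blast
qed

lemma dst_append_outside:
  assumes H: "subgroup H G" and rw: "rw (x @ y)" and n: "\<not> pre H x"
  shows "dst H (H #> val (x @ y)) = dst H (H #> val x) + length y"
proof -
  obtain q b where x: "x = q @ [b]"
    using n pre_Nil[OF H] by (metis rev_exhaust)
  have out: "\<not> pre H (q @ [b])" "rw (q @ b # y)" "rw (q @ b # [])"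
    using n rw rw_appendD(1)[OF rw] x by auto
  show ?thesis
    using dst_outside[OF H out(2,1)] dst_outside[OF H out(3,1)] x by simp
qed

text \<open>The prefixes \<open>x\<close> and \<open>x'\<close> follow the rays of \<open>g\<close>
  and \<open>inv g\<close> until they are outside the core. From there every letter increases the
  distance from \<open>o\<close> by one, so a cut in the long middle part \<open>m\<close> can be
  placed to make the two ends equally far up to one.\<close>

lemma balanced_exit_exists:
  assumes H: "subgroup H G" and fin: "finite (core_arcs H)"
    and g: "g \<in> carrier G" "g \<noteq> \<one>" and n: "\<And>m. g [^] Suc m \<notin> H"
  obtains n :: nat and p a p' where "n > 0" "balanced_exit G S H p a p'" "g [^] n = val (p @ a # winv p')"
    "dst H (H #> val p) \<ge> L" "dst H (H #> val p') \<ge> L"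
proof -
  have nf: "rw (nf g)" "val (nf g) = g" "nf g \<noteq> []"
    using nf_props[OF g(1)] g by auto
  obtain u c where uc: "nf g = u @ c @ winv u" "c \<noteq> []" "rw (c @ c)"
    using cyclically_reduced_conjugate nf by blast
  have S: "set u \<subseteq> S" "set c \<subseteq> S"
    using uc(1) rw_set[OF nf(1)] by auto
  have gv: "val (u @ c @ winv u) = g"
    using nf(2) uc(1) by simp
  obtain k where k: "\<not> pre H (u @ wpow c k)"
    using ray_leaves_core[OF H fin uc(2) S] n gv by metis
  have "val (u @ winv c @ winv u) = inv g"
    unfolding gv[symmetric] using S by (simp add: inv_mult_group m_assoc)
  moreover have "inv g [^] Suc m \<notin> H" for m
  proof
    assume "inv g [^] Suc m \<in> H"
    then have "inv (g [^] Suc m) \<in> H"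
      using nat_pow_inv[OF g(1)] by metis
    then have "inv (inv (g [^] Suc m)) \<in> H"
      by (rule subgroup.m_inv_closed[OF H])
    then show False
      using n g by (metis inv_inv nat_pow_closed)
  qed
  ultimately obtain l where l: "\<not> pre H (u @ wpow (winv c) l)"
    using ray_leaves_core[OF H fin _ S(1) set_winv[OF S(2)]] uc(2) by (metis winv_eq_Nil)
  define x where "x = u @ wpow c k"
  define x' where "x' = u @ wpow (winv c) l"
  define d where "d = dst H (H #> val x)"
  define d' where "d' = dst H (H #> val x')"
  \<comment> \<open>So long a middle part keeps the cut position inside \<open>m\<close> and leaves
    both ends at distance at least \<open>L\<close>.\<close>
  define M where "M = d + d' + 2 * L + 4"
  define m where "m = wpow c M"
  \<comment> \<open>The ends will lie at distances \<open>d + i\<close> and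
    \<open>d' + length m - Suc i\<close>; halving makes them differ by at most one.\<close>
  define i where "i = (d' + length m - d) div 2"
  define N where "N = k + M + l"
  have "length m = M * length c"
    unfolding m_def by (simp add: length_concat sum_list_replicate)
  moreover have "length c \<ge> 1"
    using uc(2) by (cases c) auto
  ultimately have lm: "length m \<ge> M"
    by (metis mult.right_neutral mult_le_mono2)
  have i: "i < length m" "2 * i \<le> d' + length m - d" "d' + length m - d \<le> 2 * i + 1"
    using lm unfolding i_def M_def by auto
  define y where "y = take i m"
  define a where "a = m ! i"
  define y' where "y' = winv (drop (Suc i) m)"
  have Sm: "set m \<subseteq> S" unfolding m_def using set_wpow S by blast
  then have Sd: "set (drop (Suc i) m) \<subseteq> S"
    using set_drop_subset[of "Suc i" m] by blast
  have my: "m = y @ a # winv y'"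
    unfolding y_def a_def y'_def using id_take_nth_drop[OF i(1)] Sd by simp
  have wx': "winv x' = wpow c l @ winv u"
    unfolding x'_def using S by (simp add: winv_wpow)
  define p where "p = x @ y"
  define p' where "p' = x' @ y'"
  have W: "p @ a # winv p' = u @ wpow c N @ winv u"
    unfolding p_def p'_def N_def wpow_add using wx' my by (simp add: x_def m_def)
  have "N = Suc (N - 1)" unfolding N_def M_def by simp
  then have rwW: "rw (p @ a # winv p')"
    using rw_conj_wpow[OF uc(2,3), of u "N - 1"] nf(1) uc(1) unfolding W by metis
  have Sp': "set p' \<subseteq> S"
    unfolding p'_def x'_def y'_def using S Sd set_wpow[OF set_winv[OF S(2)]] by simp
  have rwW': "rw (p' @ inv a # winv p)"
    using rw_winv[OF rwW] Sp' by (simp add: winv_Cons)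
  have dp: "dst H (H #> val p) = d + i"
  proof -
    have "rw (x @ y)" using rwW rw_appendD unfolding p_def by blast
    then have "dst H (H #> val (x @ y)) = d + length y"
      unfolding d_def using dst_append_outside[OF H] k x_def by blast
    then show ?thesis using i(1) by (simp add: p_def y_def)
  qed
  have dp': "dst H (H #> val p') = d' + (length m - Suc i)"
  proof -
    have "rw (x' @ y')" using rwW' rw_appendD unfolding p'_def by blast
    then have "dst H (H #> val (x' @ y')) = d' + length y'"
      unfolding d'_def using dst_append_outside[OF H] l x'_def by blast
    then show ?thesis by (simp add: p'_def y'_def)
  qed
  have e: "\<not> pre H (p @ [a])"
    using k pre_appendD[of H x "y @ [a]"] by (auto simp: p_def x_def)
  have e': "\<not> pre H (p' @ [inv a])"
    using l pre_appendD[of H x' "y' @ [inv a]"] by (auto simp: p'_def x'_def)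
  have bal: "dst H (H #> val p) \<le> Suc (dst H (H #> val p'))"
    "dst H (H #> val p') \<le> Suc (dst H (H #> val p))"
    "L \<le> dst H (H #> val p)" "L \<le> dst H (H #> val p')"
    using i lm unfolding dp dp' M_def by auto
  show ?thesis
  proof (rule that[of N p a p'])
    show "N > 0" unfolding N_def M_def by simp
    show "balanced_exit G S H p a p'"
      by (intro balanced_exit.intro balanced_exit_axioms.intro symmetric_free_generators_axioms
          H rwW Sp' e e' bal)
    show "g [^] N = val (p @ a # winv p')"
      unfolding W using val_conj_wpow[OF S, of N] gv by simp
  qed (rule bal)+
qed

end

section \<open>Missing arcs and infinite index\<close>

context cayley_letters
begin

text \<open>The word \<open>q @ [b]\<close> leaves the core and is extended to a cyclically reduced
  word \<open>f\<close>. With finitely many cosets some positive power of \<open>f\<close> would lie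
  in \<open>H\<close>, and its reduced word starts with \<open>q @ [b]\<close>.\<close>

lemma infinite_index:
  assumes H: "subgroup H G" and v: "v \<in> core_verts H" and b: "b \<in> S" "(v, b) \<notin> core_arcs H"
  shows "infinite (rcosets H)"
proof
  assume fin: "finite (rcosets H)"
  obtain q where q: "v = H #> val q" "pre H q"
    using v by (auto simp: core_verts_def)
  have rq: "rw q" using q pre_rw by blast
  \<comment> \<open>If \<open>b\<close> cancelled the last letter of \<open>q\<close>, the missing
    arc would be the inverse of the core arc by which \<open>q\<close> arrives.\<close>
  have rqb: "rw (q @ [b])"
  proof (rule ccontr)
    assume "\<not> rw (q @ [b])"
    then have ne: "q \<noteq> []" "b = inv (last q)"
      using rq b by (auto simp: rw_append)
    obtain q1 d where q1: "q = q1 @ [d]"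
      using ne(1) by (metis rev_exhaust)
    have d: "d \<in> S" "set q1 \<subseteq> S" "b = inv d"
      using q1 rw_set[OF rq] ne(2) by simp_all
    have "(H #> val q1, d) \<in> core_arcs H"
      using q q1 core_arcsI by blast
    then have "inverse_arc G (H #> val q1, d) \<in> core_arcs H"
      by (rule core_arcs_inverse[OF H])
    then have "(v, b) \<in> core_arcs H"
      using q q1 d rcos_val_snoc[OF H, of q1 d] by (simp add: inverse_arc_def)
    then show False using b by simp
  qed
  have n: "\<not> pre H (q @ [b])"
    using b q core_arcsI by blast
  \<comment> \<open>Two letters are forbidden, one for each junction of the periodic word, and
    \<open>S\<close> has at least four.\<close>
  have "\<exists>d \<in> S. d \<noteq> inv b \<and> d \<noteq> inv (hd (q @ [b]))"
  proof (rule ccontr)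
    assume "\<not> ?thesis"
    then have "S \<subseteq> {inv b, inv (hd (q @ [b]))}" by blast
    then have "card S \<le> card {inv b, inv (hd (q @ [b]))}"
      by (intro card_mono) auto
    also have "\<dots> \<le> 2"
      by (simp add: card_insert_if)
    finally show False using card_S rank by simp
  qed
  then obtain d where d: "d \<in> S" "d \<noteq> inv b" "d \<noteq> inv (hd (q @ [b]))" by blast
  define f where "f = (q @ [b]) @ [d]"
  have rf: "rw f"
    unfolding f_def using rqb d by (subst rw_append) auto
  have hdS: "hd (q @ [b]) \<in> S"
    using rw_set[OF rqb] hd_in_set[of "q @ [b]"] by blast
  have hdf: "hd f = hd (q @ [b])" "last f = d"
    unfolding f_def by (cases q; simp)+
  have "hd (q @ [b]) \<noteq> inv d"
    using d hdS by auto
  then have ff: "rw (f @ f)"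
    using rf hdf by (simp add: rw_append)
  have Sf: "set f \<subseteq> S" using rf rw_set by blast
  have "(\<lambda>i::nat. H #> (\<one> \<otimes> val f [^] i)) ` UNIV \<subseteq> rcosets H"
  proof
    fix v assume "v \<in> (\<lambda>i::nat. H #> (\<one> \<otimes> val f [^] i)) ` UNIV"
    then obtain i :: nat where "v = H #> (\<one> \<otimes> val f [^] i)" by blast
    moreover have "\<one> \<otimes> val f [^] i \<in> carrier G" using Sf by simp
    ultimately show "v \<in> rcosets H" unfolding RCOSETS_def by blast
  qed
  then have "\<not> inj (\<lambda>i::nat. H #> (\<one> \<otimes> val f [^] i))"
    using fin finite_imageD finite_subset infinite_UNIV_nat by metis
  then obtain i j :: nat where "H #> (\<one> \<otimes> val f [^] i) = H #> (\<one> \<otimes> val f [^] j)" "i \<noteq> j"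
    by (auto simp: inj_def)
  then obtain i j :: nat where "H #> (\<one> \<otimes> val f [^] i) = H #> (\<one> \<otimes> val f [^] j)" "i < j"
    by (metis linorder_neqE_nat)
  then obtain m where "\<one> \<otimes> val f [^] Suc m \<otimes> inv \<one> \<in> H"
    using pow_coset_eq[OF H, of "val f" \<one> i j] Sf by auto
  then have "val (wpow f (Suc m)) \<in> H"
    using Sf val_wpow[OF Sf, of "Suc m"] by (simp del: nat_pow_Suc replicate.simps)
  moreover have "wpow f (Suc m) = (q @ [b]) @ (d # wpow f m)"
    by (simp add: f_def)
  ultimately have "pre H (q @ [b])"
    using rw_wpow[OF ff, of "Suc m"] by (metis pre_rwI)
  then show False using n by simp
qed

section \<open>Comparison of deficits\<close>

text \<open>\<open>qverts\<close> and \<open>qarcs\<close> describe the graph traced in the cosets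
  of \<open>H\<close> by the words in \<open>Q\<close>, with each arc and its inverse; for
  \<open>pre H\<close> this is the core.\<close>

definition qverts :: "'a set \<Rightarrow> ('a list \<Rightarrow> bool) \<Rightarrow> 'a set set" where
  "qverts H Q = {H #> val q | q. Q q}"

definition qarcs :: "'a set \<Rightarrow> ('a list \<Rightarrow> bool) \<Rightarrow> ('a set \<times> 'a) set" where
  "qarcs H Q = {(H #> val q, b) | q b. Q (q @ [b])} \<union>
    {(H #> val (q @ [b]), inv b) | q b. Q (q @ [b])}"

definition weight :: "'a set \<Rightarrow> 'a set \<Rightarrow> real" where
  "weight H v = 1 / (2 * real r - 1) ^ dst H v"

definition free_arcs :: "('a set \<times> 'a) set \<Rightarrow> 'a set \<Rightarrow> real" where
  "free_arcs A v = real (card {b \<in> S. (v, b) \<notin> A})"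

text \<open>These sets of words trace finite graphs that contain the core and in which every vertex
  is reached by a reduced path.\<close>

definition path_closed :: "'a set \<Rightarrow> ('a list \<Rightarrow> bool) \<Rightarrow> bool" where
  "path_closed H Q \<longleftrightarrow> (\<forall>w. pre H w \<longrightarrow> Q w) \<and> (\<forall>w. Q w \<longrightarrow> rw w) \<and>
    (\<forall>v w. Q (v @ w) \<longrightarrow> Q v) \<and> finite (qverts H Q)"

lemma base_gt: "2 * real r - 1 > 1"
  using rank by simp

lemma weight_pos: "weight H v > 0"
  using base_gt by (simp add: weight_def)

lemma deficit_core_weight:
  assumes "subgroup H G" "finite (core_verts H)"
  shows "deficit r H (core G X H) =
    (\<Sum>v\<in>core_verts H. free_arcs (core_arcs H) v * weight H v)"
  using deficit_core[OF assms] by (simp add: free_arcs_def weight_def)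

lemma qverts_pre: "qverts H (pre H) = core_verts H"
  by (auto simp: qverts_def core_verts_def)

lemma qarcs_pre:
  assumes H: "subgroup H G"
  shows "qarcs H (pre H) = core_arcs H"
proof -
  have "(H #> val (q @ [b]), inv b) \<in> core_arcs H" if "pre H (q @ [b])" for q b
  proof -
    have "set q \<subseteq> S" "b \<in> S"
      using that pre_rw rw_set[of "q @ [b]"] by auto
    then show ?thesis
      using core_arcs_inverse[OF H core_arcsI[OF that]] rcos_val_snoc[OF H, of q b]
      by (simp add: inverse_arc_def)
  qed
  then show ?thesis
    by (auto simp: qarcs_def core_arcs_def)
qed

lemma qarcs_ends:
  assumes H: "subgroup H G" and Q: "path_closed H Q" and e: "(v, b) \<in> qarcs H Q"
  shows "v \<in> qverts H Q" "v #> b \<in> qverts H Q" "b \<in> S" "(v #> b, inv b) \<in> qarcs H Q"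
proof -
  obtain q d where qd: "Q (q @ [d])"
    and vb: "v = H #> val q \<and> b = d \<or> v = H #> val (q @ [d]) \<and> b = inv d"
    using e by (auto simp: qarcs_def)
  have q: "Q q" "rw (q @ [d])"
    using qd Q unfolding path_closed_def by blast+
  have S: "set q \<subseteq> S" "d \<in> S"
    using rw_set[OF q(2)] by auto
  have fwd: "H #> val q #> d = H #> val (q @ [d])"
    by (rule rcos_val_snoc[OF H S])
  have bwd: "H #> val (q @ [d]) #> inv d = H #> val q"
    using S by (simp add: rcos_mult[OF H] m_assoc)
  have mem: "H #> val q \<in> qverts H Q" "H #> val (q @ [d]) \<in> qverts H Q"
    "(H #> val q, d) \<in> qarcs H Q" "(H #> val (q @ [d]), inv d) \<in> qarcs H Q"
    using q(1) qd unfolding qverts_def qarcs_def by blast+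
  have "v \<in> qverts H Q \<and> v #> b \<in> qverts H Q \<and> b \<in> S \<and> (v #> b, inv b) \<in> qarcs H Q"
    using vb
  proof
    assume *: "v = H #> val q \<and> b = d"
    then have "v #> b = H #> val (q @ [d])" "inv b = inv d"
      using fwd by auto
    then show ?thesis using * mem S by metis
  next
    assume *: "v = H #> val (q @ [d]) \<and> b = inv d"
    then have "v #> b = H #> val q" "inv b = d"
      using bwd S by auto
    then show ?thesis using * mem S S_inv by metis
  qed
  then show "v \<in> qverts H Q" "v #> b \<in> qverts H Q" "b \<in> S" "(v #> b, inv b) \<in> qarcs H Q"
    by blast+
qed

text \<open>One new arc takes away at most one free label, and only at its source
  \<open>s\<close>.\<close>

lemma sum_free_arcs_remove:
  assumes "finite V"
  shows "(\<Sum>v\<in>V. free_arcs A v * weight H v) - weight H s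
    \<le> (\<Sum>v\<in>V. free_arcs (insert (s, b) A) v * weight H v)"
proof -
  have le: "free_arcs A v * weight H v - (if v = s then weight H s else 0)
      \<le> free_arcs (insert (s, b) A) v * weight H v" for v
  proof (cases "v = s")
    case True
    have "{c \<in> S. (s, c) \<notin> insert (s, b) A} = {c \<in> S. (s, c) \<notin> A} - {b}"
      by auto
    then have "free_arcs (insert (s, b) A) s \<ge> free_arcs A s - 1"
      using diff_card_le_card_Diff[of "{b}" "{c \<in> S. (s, c) \<notin> A}"]
      unfolding free_arcs_def by simp
    then have "(free_arcs A s - 1) * weight H s \<le> free_arcs (insert (s, b) A) s * weight H s"
      using weight_pos[of H s] by (intro mult_right_mono) auto
    then show ?thesis using True by (simp add: algebra_simps)
  next
    case False
    then have "{c \<in> S. (v, c) \<notin> insert (s, b) A} = {c \<in> S. (v, c) \<notin> A}"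
      by auto
    then show ?thesis using False by (simp add: free_arcs_def)
  qed
  have "(\<Sum>v\<in>V. if v = s then weight H s else 0) \<le> weight H s"
    using assms weight_pos[of H s] by (simp add: sum.delta)
  moreover have "(\<Sum>v\<in>V. free_arcs A v * weight H v - (if v = s then weight H s else 0))
      \<le> (\<Sum>v\<in>V. free_arcs (insert (s, b) A) v * weight H v)"
    by (rule sum_mono) (rule le)
  ultimately show ?thesis
    by (simp add: sum_subtractf)
qed

text \<open>The new vertex has \<open>2 r - 1\<close> free arcs of weight \<open>weight H v / (2 r - 1)\<close> each, which
  makes up for the arc lost at \<open>v\<close>.\<close>

lemma add_arc:
  assumes H: "subgroup H G" and Q: "path_closed H Q" and q: "Q q" and rw: "rw (q @ [b])"
  defines "Q' \<equiv> \<lambda>w. Q w \<or> w = q @ [b]"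
  shows "path_closed H Q'"
    and "(\<Sum>v\<in>qverts H Q. free_arcs (qarcs H Q) v * weight H v)
      \<le> (\<Sum>v\<in>qverts H Q'. free_arcs (qarcs H Q') v * weight H v)"
proof -
  define s where "s = H #> val q"
  define s' where "s' = H #> val (q @ [b])"
  have S: "set q \<subseteq> S" "b \<in> S"
    using rw_set[OF rw] by auto
  have fin: "finite (qverts H Q)"
    using Q by (simp add: path_closed_def)
  have V': "qverts H Q' = insert s' (qverts H Q)"
    by (auto simp: qverts_def Q'_def s'_def)
  have A': "qarcs H Q' = insert (s, b) (insert (s', inv b) (qarcs H Q))"
    by (auto simp: qarcs_def Q'_def s_def s'_def)
  have s: "s \<in> qverts H Q"
    using q by (auto simp: qverts_def s_def)
  have ss': "s #> b = s'"
    unfolding s_def s'_def by (rule rcos_val_snoc[OF H S])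
  have "Q' v" if "Q' (v @ w)" for v w
  proof (cases "Q (v @ w)")
    case True
    then show ?thesis using Q unfolding path_closed_def Q'_def by blast
  next
    case False
    then have vw: "v @ w = q @ [b]" using that by (simp add: Q'_def)
    show ?thesis
    proof (cases w rule: rev_cases)
      case Nil
      then show ?thesis using vw by (simp add: Q'_def)
    next
      case (snoc u c)
      then have "q = v @ u" using vw by simp
      then show ?thesis using q Q unfolding path_closed_def Q'_def by blast
    qed
  qed
  moreover have "finite (qverts H Q')"
    using fin V' by simp
  ultimately show "path_closed H Q'"
    using Q rw unfolding path_closed_def Q'_def by blast
  show "(\<Sum>v\<in>qverts H Q. free_arcs (qarcs H Q) v * weight H v)
      \<le> (\<Sum>v\<in>qverts H Q'. free_arcs (qarcs H Q') v * weight H v)"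
  proof (cases "(s, b) \<in> qarcs H Q")
    case True
    then have "s' \<in> qverts H Q" "(s', inv b) \<in> qarcs H Q"
      using qarcs_ends[OF H Q True] ss' by auto
    then have "qverts H Q' = qverts H Q" "qarcs H Q' = qarcs H Q"
      using True V' A' by auto
    then show ?thesis by simp
  next
    case False
    have n: "\<not> pre H (q @ [b])"
      using False Q by (auto simp: path_closed_def qarcs_def s_def)
    \<comment> \<open>A word in \<open>Q\<close> reaching \<open>s'\<close> would have to end with
      \<open>b\<close> from the coset \<open>s\<close>, so the arc would be present already. Hence
      the new arc ends at a new vertex, where only the way back is occupied.\<close>
    have new: "s' \<notin> qverts H Q"
    proof
      assume "s' \<in> qverts H Q"
      then obtain q1 where q1: "s' = H #> val q1" "Q q1"
        by (auto simp: qverts_def)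
      have "rw q1" using q1 Q by (simp add: path_closed_def)
      then obtain q2 where "q1 = q2 @ [b]" "H #> val q2 = H #> val q"
        using coset_rep_outside[OF H rw _ n] q1(1) s'_def by metis
      then show False
        using False q1(2) by (auto simp: qarcs_def s_def)
    qed
    have ne: "s \<noteq> s'" using s new by blast
    have "(s', c) \<notin> qarcs H Q" for c
      using new qarcs_ends(1)[OF H Q] by blast
    then have "{c \<in> S. (s', c) \<notin> qarcs H Q'} = S - {inv b}"
      using ne A' by auto
    then have "free_arcs (qarcs H Q') s' = 2 * real r - 1"
      using fin_S card_S S_inv[OF S(2)] rank by (simp add: free_arcs_def of_nat_diff)
    moreover have "dst H s' = Suc (dst H s)"
      using dst_outside[OF H rw n] by (simp add: s_def s'_def)
    ultimately have gain: "free_arcs (qarcs H Q') s' * weight H s' = weight H s"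
      using base_gt by (simp add: weight_def)
    have "free_arcs (qarcs H Q') v = free_arcs (insert (s, b) (qarcs H Q)) v"
      if "v \<in> qverts H Q" for v
    proof -
      have "v \<noteq> s'" using that new by blast
      then show ?thesis by (simp add: free_arcs_def A')
    qed
    then have "(\<Sum>v\<in>qverts H Q. free_arcs (qarcs H Q') v * weight H v) =
        (\<Sum>v\<in>qverts H Q. free_arcs (insert (s, b) (qarcs H Q)) v * weight H v)"
      by simp
    then show ?thesis
      using sum_free_arcs_remove[OF fin, of "qarcs H Q" H s b] gain fin new
      by (simp add: V')
  qed
qed

text \<open>The path is attached one arc at a time, and by \<open>add_arc\<close> no step lowers the
  weighted sum.\<close>

lemma add_path:
  assumes H: "subgroup H G" and Q: "path_closed H Q" and "rw p"
  defines "Q' \<equiv> \<lambda>w. Q w \<or> (\<exists>z. p = w @ z)"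
  shows "path_closed H Q'"
    and "(\<Sum>v\<in>qverts H Q. free_arcs (qarcs H Q) v * weight H v)
      \<le> (\<Sum>v\<in>qverts H Q'. free_arcs (qarcs H Q') v * weight H v)"
proof -
  let ?D = "\<lambda>Q. \<Sum>v\<in>qverts H Q. free_arcs (qarcs H Q) v * weight H v"
  have "path_closed H (\<lambda>w. Q w \<or> (\<exists>z. p = w @ z)) \<and> ?D Q \<le> ?D (\<lambda>w. Q w \<or> (\<exists>z. p = w @ z))"
    using \<open>rw p\<close>
  proof (induction p rule: rev_induct)
    case Nil
    have "(\<lambda>w. Q w \<or> (\<exists>z. [] = w @ z)) = Q"
      using Q pre_Nil[OF H] by (auto simp: path_closed_def)
    then show ?case using Q by simp
  next
    case (snoc b p)
    let ?Q = "\<lambda>w. Q w \<or> (\<exists>z. p = w @ z)"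
    have IH: "path_closed H ?Q" "?D Q \<le> ?D ?Q"
      using snoc.IH snoc.prems rw_appendD(1) by blast+
    have "(p @ [b] = w @ z) \<longleftrightarrow> (w = p @ [b] \<and> z = []) \<or> (\<exists>y. z = y @ [b] \<and> p = w @ y)" for w z
      by (cases z rule: rev_cases) auto
    then have eq: "(\<lambda>w. Q w \<or> (\<exists>z. p @ [b] = w @ z)) = (\<lambda>w. ?Q w \<or> w = p @ [b])"
      by (intro ext) blast
    have "?Q p" by auto
    note add_arc[OF H IH(1) this snoc.prems]
    then show ?case
      unfolding eq using IH(2) by linarith
  qed
  then show "path_closed H Q'" "?D Q \<le> ?D Q'"
    unfolding Q'_def by blast+
qed

end

locale balanced_exit_letters = balanced_exit + cayley_letters
begin

lemma inside_path_closed: "finite (core_verts H) \<Longrightarrow> path_closed H inside"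
  and deficit_le_inside: "finite (core_verts H) \<Longrightarrow> deficit r H (core G X H)
    \<le> (\<Sum>v\<in>qverts H inside. free_arcs (qarcs H inside) v * weight H v)"
proof -
  assume fin: "finite (core_verts H)"
  have pc: "path_closed H (pre H)"
    using fin pre_rw pre_appendD qverts_pre by (auto simp: path_closed_def)
  have rp: "rw p" "rw p'"
    using rw_path rw_path' rw_appendD by blast+
  have eq: "inside = (\<lambda>w. (pre H w \<or> (\<exists>z. p = w @ z)) \<or> (\<exists>z. p' = w @ z))"
    by (intro ext) (simp add: inside_def)
  note 1 = add_path[OF H pc rp(1)]
  note 2 = add_path[OF H 1(1) rp(2)]
  show "path_closed H inside"
    unfolding eq by (rule 2(1))
  show "deficit r H (core G X H)
    \<le> (\<Sum>v\<in>qverts H inside. free_arcs (qarcs H inside) v * weight H v)"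
    unfolding deficit_core_weight[OF H fin] eq using 1(2) 2(2)
    by (simp add: qverts_pre qarcs_pre[OF H])
qed

lemma inside_rw: "inside q \<Longrightarrow> rw q"
  using pre_rw rw_path rw_path' rw_appendD unfolding inside_def by metis

text \<open>The graph of \<open>inside\<close> has at least the deficit of the core of
  \<open>H\<close>; adding the two exit arcs costs at most the two weights. Its vertices map
  injectively into the core of \<open>H1\<close>, where distances do not grow and missing arcs stay
  missing.\<close>

lemma deficit_loss:
  assumes fin: "finite (core_verts H)" and fin1: "finite (core_verts H1)"
  shows "deficit r H (core G X H) - deficit r H1 (core G X H1)
    \<le> weight H (H #> val p) + weight H (H #> val p')"
proof -
  define V where "V = qverts H inside"
  define A where "A = insert (H #> val p, a) (insert (H #> val p', inv a) (qarcs H inside))"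
  have finV: "finite V"
    using inside_path_closed[OF fin] by (simp add: path_closed_def V_def)
  have "deficit r H (core G X H) - weight H (H #> val p') - weight H (H #> val p)
      \<le> (\<Sum>v\<in>V. free_arcs A v * weight H v)"
    using deficit_le_inside[OF fin] sum_free_arcs_remove[OF finV, of "qarcs H inside" H "H #> val p'" "inv a"]
      sum_free_arcs_remove[OF finV, of "insert (H #> val p', inv a) (qarcs H inside)" H "H #> val p" a]
    unfolding A_def V_def by linarith
  also have "(\<Sum>v\<in>V. free_arcs A v * weight H v) \<le>
      (\<Sum>v\<in>core_verts H1. free_arcs (core_arcs H1) v * weight H1 v)"
  proof -
    have "\<forall>v\<in>V. \<exists>q. inside q \<and> v = H #> val q"
      by (auto simp: V_def qverts_def)
    then obtain rep where rep: "\<And>v. v \<in> V \<Longrightarrow> inside (rep v)" "\<And>v. v \<in> V \<Longrightarrow> v = H #> val (rep v)"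
      by metis
    define \<phi> where "\<phi> v = H1 #> val (rep v)" for v
    have inj: "inj_on \<phi> V"
      unfolding \<phi>_def inj_on_def using inside_coset_inj inside_rw rep by metis
    have img: "\<phi> ` V \<subseteq> core_verts H1"
      unfolding \<phi>_def using inside_pre_H1 core_vertsI rep by blast
    have le: "free_arcs A v * weight H v \<le> free_arcs (core_arcs H1) (\<phi> v) * weight H1 (\<phi> v)"
      if v: "v \<in> V" for v
    proof (rule mult_mono)
      define q where "q = rep v"
      have q: "inside q" "v = H #> val q" "rw q" "set q \<subseteq> S"
        using rep[OF v] inside_rw rw_set by (auto simp: q_def)
      \<comment> \<open>An arc of the core of \<open>H1\<close> at \<open>\<phi> v\<close> either
        leads back along \<open>q\<close>, or extends \<open>q\<close> and is then inside or an exit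
        by \<open>inside_core_arc\<close>; in each case the corresponding arc at \<open>v\<close> is
        in \<open>A\<close>.\<close>
      have "{b \<in> S. (v, b) \<notin> A} \<subseteq> {b \<in> S. (\<phi> v, b) \<notin> core_arcs H1}"
      proof safe
        fix b assume b: "b \<in> S" "(v, b) \<notin> A" "(\<phi> v, b) \<in> core_arcs H1"
        have arc: "(H1 #> val q, b) \<in> core_arcs H1"
          using b(3) by (simp add: \<phi>_def q_def)
        show False
        proof (cases "rw (q @ [b])")
          case True
          have "pre H1 (q @ [b])"
            by (rule core_arcs_pre[OF H1 True arc])
          then have "(\<exists>q2. inside (q2 @ [b]) \<and> H #> val q2 = H #> val q) \<or>
              (\<exists>q2. (q2, b) \<in> exits \<and> H #> val q2 = H #> val q)"
            by (rule inside_core_arc[OF q(1) True])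
          then have "(H #> val q, b) \<in> A"
            unfolding A_def qarcs_def exits_def by fastforce
          then show False using b q by simp
        next
          case False
          then have ne: "q \<noteq> []" "b = inv (last q)"
            using q(3) b by (auto simp: rw_append)
          then obtain q1 d where q1: "q = q1 @ [d]"
            by (metis rev_exhaust)
          then have "(H #> val q, b) \<in> qarcs H inside"
            using q(1) ne unfolding qarcs_def by auto
          then show False using b q by (simp add: A_def)
        qed
      qed
      then show "free_arcs A v \<le> free_arcs (core_arcs H1) (\<phi> v)"
        unfolding free_arcs_def using fin_S by (simp add: card_mono)
      obtain w where w: "rw w" "H #> val w = H #> val q" "length w = dst H (H #> val q)"
        using least_word[OF H, of "val q"] q by auto
      have Sw: "set w \<subseteq> S" using w rw_set by blast
      have "val w \<otimes> inv (val q) \<in> H1"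
        using w(2) rcos_eq_iff[OF H] Sw q H_le_H1 by auto
      then have "H1 #> val w = \<phi> v"
        unfolding \<phi>_def q_def[symmetric]
        by (rule iffD2[OF rcos_eq_iff[OF H1 val_closed[OF Sw] val_closed[OF q(4)]]])
      then have "dst H1 (\<phi> v) \<le> dst H v"
        using dst_le[OF Sw, of H1] w(3) q(2) by simp
      then show "weight H v \<le> weight H1 (\<phi> v)"
        unfolding weight_def using base_gt by (intro divide_left_mono power_increasing) auto
    qed (use weight_pos in \<open>auto simp: free_arcs_def less_imp_le\<close>)
    have "(\<Sum>v\<in>V. free_arcs A v * weight H v) \<le>
        (\<Sum>v\<in>V. free_arcs (core_arcs H1) (\<phi> v) * weight H1 (\<phi> v))"
      by (rule sum_mono) (rule le)
    also have "\<dots> = (\<Sum>v\<in>\<phi> ` V. free_arcs (core_arcs H1) v * weight H1 v)"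
      using inj by (simp add: sum.reindex)
    \<comment> \<open>The vertices of the core of \<open>H1\<close> outside the image, which lie
      deep in the graph or on the far side, only add non-negative terms.\<close>
    also have "\<dots> \<le> (\<Sum>v\<in>core_verts H1. free_arcs (core_arcs H1) v * weight H1 v)"
      using fin1 img weight_pos by (intro sum_mono2) (auto simp: free_arcs_def less_imp_le)
    finally show ?thesis .
  qed
  finally show ?thesis
    unfolding deficit_core_weight[OF H1 fin1] by linarith
qed

end

section \<open>The theorem\<close>

lemma letter_words:
  assumes "set w \<subseteq> letter_val G ` (X \<times> UNIV)"
  obtains ls where "fst ` set ls \<subseteq> X" "map (letter_val G) ls = w"
proof -
  have "\<exists>ls. fst ` set ls \<subseteq> X \<and> map (letter_val G) ls = w"
    using assms
  proof (induction w)
    case (Cons a w)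
    obtain x s where x: "x \<in> X" "a = letter_val G (x, s)"
      using Cons.prems by auto
    have "set w \<subseteq> letter_val G ` (X \<times> UNIV)"
      using Cons.prems by simp
    from Cons.IH[OF this] obtain ls where "fst ` set ls \<subseteq> X" "map (letter_val G) ls = w"
      by blast
    then show ?case
      using x by (intro exI[of _ "(x, s) # ls"]) simp
  qed simp
  then show ?thesis using that by blast
qed

text \<open>This passes from signed basis elements to group elements as letters. Injectivity on
  one-letter words already shows that the \<open>2 * r\<close> letters are distinct and that none is
  its own inverse.\<close>

lemma (in group) free_basis_cayley_letters:
  assumes X: "free_basis G X" "finite X" and r: "card X = r" "r > 1"
  shows "cayley_letters G (sym_letters G X) X r"
proof -
  have Xc: "X \<subseteq> carrier G" and gen: "generate G X = carrier G"
    and inj: "inj_on (\<lambda>w. group_prod G (map (letter_val G) w)) (reduced_words X)"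
    using X by (auto simp: free_basis_def)
  define S where "S = sym_letters G X"
  have S: "S = letter_val G ` (X \<times> UNIV)"
  proof (intro equalityI subsetI)
    fix a assume "a \<in> S"
    then consider "a \<in> X" | x where "x \<in> X" "a = inv x"
      by (auto simp: S_def sym_letters_def)
    then show "a \<in> letter_val G ` (X \<times> UNIV)"
    proof cases
      case 1
      then have "(a, True) \<in> X \<times> UNIV" "a = letter_val G (a, True)"
        by (auto simp: letter_val_def)
      then show ?thesis by blast
    next
      case (2 x)
      then have "(x, False) \<in> X \<times> UNIV" "a = letter_val G (x, False)"
        by (auto simp: letter_val_def)
      then show ?thesis by blast
    qed
  qed (auto simp: S_def sym_letters_def letter_val_def split: if_splits)
  have lv: "letter_val G (x, s) \<in> carrier G" "letter_val G (x, \<not> s) = inv (letter_val G (x, s))"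
    if "x \<in> X" for x s
    using that Xc by (auto simp: letter_val_def)
  have Sc: "S \<subseteq> carrier G"
    unfolding S using lv by auto
  have single: "l = m" if "fst l \<in> X" "fst m \<in> X" "letter_val G l = letter_val G m" for l m
  proof -
    have "[l] \<in> reduced_words X" "[m] \<in> reduced_words X"
      using that by (auto simp: reduced_words_def)
    moreover have "group_prod G (map (letter_val G) [l]) = group_prod G (map (letter_val G) [m])"
      using that by simp
    ultimately have "[l] = [m]" using inj unfolding inj_on_def by blast
    then show ?thesis by simp
  qed
  have "cayley_letters G S X r"
  proof
    show "S \<subseteq> carrier G" by (rule Sc)
    show "inv a \<in> S" if "a \<in> S" for a
    proof -
      obtain x s where "x \<in> X" "a = letter_val G (x, s)"
        using \<open>a \<in> S\<close> S by auto
      then have "inv a = letter_val G (x, \<not> s)" "x \<in> X"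
        using lv by auto
      then show ?thesis unfolding S by blast
    qed
    show "inv a \<noteq> a" if "a \<in> S" for a
    proof
      assume "inv a = a"
      obtain x s where "x \<in> X" "a = letter_val G (x, s)"
        using \<open>a \<in> S\<close> S by auto
      then have "letter_val G (x, \<not> s) = letter_val G (x, s)" "x \<in> X"
        using lv \<open>inv a = a\<close> by auto
      then show False using single[of "(x, \<not> s)" "(x, s)"] by simp
    qed
    show "\<exists>w. set w \<subseteq> S \<and> group_prod G w = x" if "x \<in> carrier G" for x
    proof -
      have app: "group_prod G (v @ w) = group_prod G v \<otimes> group_prod G w \<and>
          group_prod G v \<in> carrier G \<and> group_prod G w \<in> carrier G"
        if "set v \<subseteq> S" "set w \<subseteq> S" for v w
      proof -
        have closed: "group_prod G u \<in> carrier G" if "set u \<subseteq> S" for u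
          using that Sc by (induction u) (auto simp: group_prod_def)
        have "group_prod G (v @ w) = group_prod G v \<otimes> group_prod G w"
          using \<open>set v \<subseteq> S\<close>
        proof (induction v)
          case Nil
          then show ?case using closed[OF \<open>set w \<subseteq> S\<close>] by (simp add: group_prod_def)
        next
          case (Cons a v)
          have "a \<in> carrier G" "group_prod G v \<in> carrier G" "group_prod G w \<in> carrier G"
            using Cons.prems closed \<open>set w \<subseteq> S\<close> Sc by auto
          then show ?case using Cons by (simp add: group_prod_def m_assoc)
        qed
        then show ?thesis using closed that by blast
      qed
      have "x \<in> generate G X" using that gen by simp
      then show ?thesis
      proof (induction rule: generate.induct)
        case one
        then show ?case by (intro exI[of _ "[]"]) (simp add: group_prod_def)
      next
        case (incl h)
        then show ?case
          using Xc by (intro exI[of _ "[h]"]) (auto simp: group_prod_def S_def sym_letters_def)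
      next
        case (inv h)
        then show ?case
          using Xc by (intro exI[of _ "[inv h]"]) (auto simp: group_prod_def S_def sym_letters_def)
      next
        case (eng h1 h2)
        then obtain v w where "set v \<subseteq> S" "group_prod G v = h1" "set w \<subseteq> S" "group_prod G w = h2"
          by blast
        then show ?case
          using app[of v w] by (intro exI[of _ "v @ w"]) auto
      qed
    qed
    show "inj_on (group_prod G) {w. set w \<subseteq> S \<and> successively (\<lambda>a b. b \<noteq> inv a) w}"
    proof (rule inj_onI)
      have coded: "\<exists>ls \<in> reduced_words X. map (letter_val G) ls = w"
        if w: "set w \<subseteq> S" "successively (\<lambda>a b. b \<noteq> inv a) w" for w
      proof -
        obtain ls where ls: "fst ` set ls \<subseteq> X" "map (letter_val G) ls = w"
          by (rule letter_words[OF w(1)[unfolded S]])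
        have "successively (\<lambda>l m. letter_val G m \<noteq> inv (letter_val G l)) ls"
          using w(2) unfolding ls(2)[symmetric] successively_map .
        moreover have "\<not> (fst l = fst m \<and> snd l \<noteq> snd m)"
          if l: "l \<in> set ls" and n: "letter_val G m \<noteq> inv (letter_val G l)" for l m
        proof
          assume lm: "fst l = fst m \<and> snd l \<noteq> snd m"
          have "fst l \<in> X" by (rule subsetD[OF ls(1) imageI[OF l]])
          then have "letter_val G (fst l, \<not> snd l) = inv (letter_val G l)"
            using lv(2)[of "fst l" "snd l"] by simp
          moreover have "m = (fst l, \<not> snd l)"
            using lm by (cases m) auto
          ultimately show False using n by simp
        qed
        ultimately have "successively (\<lambda>l m. \<not> (fst l = fst m \<and> snd l \<noteq> snd m)) ls"
          by (rule successively_mono) auto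
        then show ?thesis using ls by (auto simp: reduced_words_def)
      qed
      fix v w
      assume v: "v \<in> {w. set w \<subseteq> S \<and> successively (\<lambda>a b. b \<noteq> inv a) w}"
        and w: "w \<in> {w. set w \<subseteq> S \<and> successively (\<lambda>a b. b \<noteq> inv a) w}"
        and eq: "group_prod G v = group_prod G w"
      obtain ls ms where ls: "ls \<in> reduced_words X" "map (letter_val G) ls = v"
        and ms: "ms \<in> reduced_words X" "map (letter_val G) ms = w"
        using coded[of v] coded[of w] v w by auto
      have "ls = ms"
        using inj_onD[OF inj _ ls(1) ms(1)] ls(2) ms(2) eq by simp
      then show "v = w" using ls ms by simp
    qed
    show "sym_letters G X = S" by (simp add: S_def)
    show "finite S" unfolding S using X by simp
    have "inj_on (letter_val G) (X \<times> UNIV)"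
      by (intro inj_onI single) auto
    then have "card S = card (X \<times> (UNIV :: bool set))"
      unfolding S by (rule card_image)
    then show "card S = 2 * r"
      using r by (simp add: card_cartesian_product)
    show "r > 1" by (rule r)
  qed
  then show ?thesis by (simp add: S_def)
qed

theorem theorem5:
  fixes F :: "('a, 'b) monoid_scheme"
    and X H :: "'a set" and g :: 'a and r :: nat and \<epsilon> :: real
  assumes "group F"
    and "free_basis F X" and "finite X" and "card X = r" and "r > 1"
    and "subgroup H F" and "finitely_generated_subgroup H F"
    and "g \<in> carrier F" and "g \<noteq> \<one>\<^bsub>F\<^esub>"
    and "H \<inter> generate F {g} = {\<one>\<^bsub>F\<^esub>}"
    and "0 < \<epsilon>" and "\<epsilon> < deficit r H (core F X H)"
  shows "\<exists>n H1. n > 0 \<and> subgroup H1 F \<and> infinite (rcosets\<^bsub>F\<^esub> H1) \<and>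
           g [^]\<^bsub>F\<^esub> (n :: nat) \<in> H1 \<and>
           internal_free_product F H (generate F {g [^]\<^bsub>F\<^esub> n}) H1 \<and>
           deficit r H (core F X H) - deficit r H1 (core F X H1) \<le> \<epsilon>"
proof -
  interpret cayley_letters F "sym_letters F X" X r
    by (rule group.free_basis_cayley_letters) (use assms in auto)
  obtain T where T: "finite T" "T \<subseteq> carrier F" "H = generate F T"
    using assms(7) by (auto simp: finitely_generated_subgroup_def)
  note fin = finite_core[OF T]
  have "g [^]\<^bsub>F\<^esub> Suc m \<notin> H" for m
  proof
    assume "g [^]\<^bsub>F\<^esub> Suc m \<in> H"
    moreover have "g [^]\<^bsub>F\<^esub> Suc m \<in> generate F {g}"
      unfolding generate_pow[OF assms(8)] using int_pow_int by (metis (mono_tags, lifting) UNIV_I mem_Collect_eq)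
    ultimately show False
      using assms(10) torsion_free[OF assms(8,9), of m] by blast
  qed
  note n = this
  have "2 * real r - 1 > 1" using rank by simp
  then have "1 / (2 * real r - 1) < 1" by simp
  \<comment> \<open>Each exit arc costs at most \<open>\<epsilon> / 2\<close> once it starts at
    distance at least \<open>L\<close>.\<close>
  then obtain L where L: "(1 / (2 * real r - 1)) ^ L < \<epsilon> / 2"
    using real_arch_pow_inv[of "\<epsilon> / 2" "1 / (2 * real r - 1)"] assms(11) by auto
  obtain n :: nat and p a p' where n: "n > 0" "balanced_exit F (sym_letters F X) H p a p'"
    "g [^]\<^bsub>F\<^esub> n = val (p @ a # winv p')"
    "dst H (H #>\<^bsub>F\<^esub> val p) \<ge> L" "dst H (H #>\<^bsub>F\<^esub> val p') \<ge> L"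
    by (rule balanced_exit_exists[OF assms(6) fin(1) assms(8,9) n])
  interpret balanced_exit F "sym_letters F X" H p a p'
    by (rule n(2))
  interpret balanced_exit_letters F "sym_letters F X" H p a p' X r
    by unfold_locales
  have t: "t = g [^]\<^bsub>F\<^esub> n"
    using n(3) by simp
  \<comment> \<open>One further generator suffices, so \<open>finite_core\<close> applies to
    \<open>H1\<close> as well.\<close>
  have "H1 = generate F (insert t T)"
  proof
    have c: "insert t T \<subseteq> carrier F" using T t_closed by simp
    have "H \<subseteq> generate F (insert t T)" "K \<subseteq> generate F (insert t T)"
      unfolding T(3) by (rule mono_generate; blast)+
    then show "H1 \<subseteq> generate F (insert t T)"
      by (intro generate_subgroup_incl generate_is_subgroup[OF c]) simp
    have "T \<subseteq> H" unfolding T(3) by (auto intro: generate.incl)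
    then have "insert t T \<subseteq> H1" using H_le_H1 t_in_H1 by blast
    then show "generate F (insert t T) \<subseteq> H1"
      by (rule generate_subgroup_incl) (rule H1)
  qed
  then have fin1: "finite (core_verts H1)"
    using finite_core(2)[of "insert t T" H1] T t_closed by simp
  have small: "weight H v \<le> \<epsilon> / 2" if "dst H v \<ge> L" for v
  proof -
    have "weight H v = (1 / (2 * real r - 1)) ^ dst H v"
      by (simp add: weight_def power_divide)
    also have "\<dots> \<le> (1 / (2 * real r - 1)) ^ L"
      by (rule power_decreasing) (use that base_gt in auto)
    finally show ?thesis using L by simp
  qed
  have loss: "deficit r H (core F X H) - deficit r H1 (core F X H1) \<le> \<epsilon>"
    using deficit_loss[OF fin(2) fin1] small[OF n(4)] small[OF n(5)] by linarith
  \<comment> \<open>Here \<open>\<epsilon>\<close> being smaller than the deficit of the core of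
    \<open>H\<close> enters: a positive deficit forces a missing arc at some core vertex of
    \<open>H1\<close>, hence infinite index.\<close>
  then have "deficit r H1 (core F X H1) > 0"
    using assms(12) by simp
  then obtain v where v: "v \<in> core_verts H1" "free_arcs (core_arcs H1) v * weight H1 v > 0"
    unfolding deficit_core_weight[OF H1 fin1] by (meson not_less sum_nonpos)
  have "{b \<in> sym_letters F X. (v, b) \<notin> core_arcs H1} \<noteq> {}"
  proof
    assume "{b \<in> sym_letters F X. (v, b) \<notin> core_arcs H1} = {}"
    then have "free_arcs (core_arcs H1) v = 0"
      by (simp only: free_arcs_def card.empty of_nat_0)
    then show False using v(2) by simp
  qed
  then have "infinite (rcosets\<^bsub>F\<^esub> H1)"
    using infinite_index[OF H1 v(1)] by blast
  then show ?thesis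
    using n(1) H1 t_in_H1 internal_free_product loss unfolding t by blast
qed

end
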